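(* Let $\gamma\in(0,1)$, let $n\ge2$ be an integer, let $0\le\kappa<\Lambda_{n,\gamma}$, fix an integer $m\ge0$, and let $\sigma_j,\tau_j,c_j$ ($j\ge0$) and $\mathcal G_m$ be as in the context. Let $h:\mathbb R\to\mathbb R$ satisfy $h(t)=O(e^{-\delta t})$ as $t\to+\infty$ and $h(t)=O(e^{\delta_0t})$ as $t\to-\infty$ for some real $\delta,\delta_0>-\sigma_0$, and let $w(t)=\int_{\mathbb R}\mathcal G_m(t-t')h(t')\,dt'$ (a solution of $P_\gamma^{(m)}w-\kappa w=h$). If $\tau_j=0$ for all $j$, then $$w(t)=\sum_{j=0}^\infty c_jw_j(t),\qquad w_j(t):=\int_{\mathbb R}e^{-\sigma_j|t-t'|}h(t')\,dt',$$ and, for every $j$, $w_j$ is a particular solution of the second order ODE $$w_j''(t)-\sigma_j^2w_j(t)=-2\sigma_jh(t).$$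
   Context: $\Lambda_{n,\gamma}=2^{2\gamma}\big(\Gamma(\tfrac{n+2\gamma}{4})/\Gamma(\tfrac{n-2\gamma}{4})\big)^2$. Let $\mu_m$, $m=0,1,\dots$, be the eigenvalues of the (positive) Laplacian on $\mathbb S^{n-1}$ repeated with multiplicity, and $A_m=\frac12+\frac\gamma2+\frac12\sqrt{(\frac n2-1)^2+\mu_m}$, $B_m=\frac12-\frac\gamma2+\frac12\sqrt{(\frac n2-1)^2+\mu_m}$. $P_\gamma^{(m)}$ is the projection onto the $m$-th spherical harmonic of the conformal fractional Laplacian $P_\gamma w=r^{\frac{n+2\gamma}{2}}(-\Delta_{\mathbb R^n})^\gamma(r^{-\frac{n-2\gamma}{2}}w)$, $r=e^{-t}$, on the cylinder $\mathbb R\times\mathbb S^{n-1}$; it is the Fourier multiplier on $\mathbb R$ with symbol $$\Theta_m(\xi)=2^{2\gamma}\frac{\Gamma(A_m+\frac{\xi i}{2})\Gamma(A_m-\frac{\xi i}2)}{\Gamma(B_m+\frac{\xi i}2)\Gamma(B_m-\frac{\xi i}2)},$$ extended meromorphically to $\mathbb C$. The poles of $1/(\Theta_m(z)-\kappa)$ are at $\pm\tau_j\pm i\sigma_j$, $j\ge0$, with $\tau_0=0$, $\tau_j\ge0$, $\tau_j=0$ for all large $j$, $\sigma_j>\sigma_0>0$ for $j\ge1$. It is known that, for $h$ with the stated decay, $w=\mathcal G_m*h$ solves $P_\gamma^{(m)}w-\kappa w=h$, where $$\mathcal G_m(t)=c_0e^{-\sigma_0|t|}+\sum_{j=1}^\infty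 e^{-\sigma_j|t|}[c_j\cos(\tau_j|t|)+c_j'\sin(\tau_j|t|)]$$ for certain real constants $c_j,c_j'$ depending on $\kappa,n,\gamma$ (and $m$), and $\mathcal G_m$ is even and smooth for $t\ne0$. The right-hand side $h$ is understood to be sufficiently regular (e.g. continuous) for the ODE to make classical sense. *)

theory Defs
  imports "HOL-Complex_Analysis.Complex_Analysis"
begin

definition partial :: "'n::finite \<Rightarrow> (real^'n \<Rightarrow> real) \<Rightarrow> real^'n \<Rightarrow> real" where
  "partial i f x = deriv (\<lambda>s. f (x + s *\<^sub>R axis i 1)) 0"

primrec Ck_on :: "nat \<Rightarrow> (real^'n::finite \<Rightarrow> real) \<Rightarrow> (real^'n) set \<Rightarrow> bool" where
  "Ck_on 0 f S \<longleftrightarrow> continuous_on S f"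
| "Ck_on (Suc k) f S \<longleftrightarrow> continuous_on S f \<and>
     (\<forall>i. (\<forall>x\<in>S. (\<lambda>s. f (x + s *\<^sub>R axis i 1)) differentiable (at 0)) \<and> Ck_on k (partial i f) S)"

definition laplacian :: "(real^'n::finite \<Rightarrow> real) \<Rightarrow> real^'n \<Rightarrow> real" where
  "laplacian f x = (\<Sum>i\<in>UNIV. partial i (partial i f) x)"

text \<open>Functions on the unit sphere are represented by functions on the ambient space of which
  only the values on the sphere matter. The Laplace-Beltrami operator of the sphere is the
  Euclidean Laplacian of the extension that is homogeneous of degree 0.\<close>

definition radial_ext :: "(real^'n::finite \<Rightarrow> real) \<Rightarrow> real^'n \<Rightarrow> real" where
  "radial_ext u x = u (x /\<^sub>R norm x)"

definition sphere_eigenspace :: "real \<Rightarrow> (real^'n::finite \<Rightarrow> real) set" where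
  "sphere_eigenspace \<nu> = {u. (\<forall>k. Ck_on k (radial_ext u) (- {0})) \<and>
     (\<forall>x\<in>sphere 0 1. - laplacian (radial_ext u) x = \<nu> * u x)}"

text \<open>\<open>\<mu>\<close> lists the eigenvalues of the positive Laplacian on the sphere, repeated with
  multiplicity: there are eigenfunctions \<open>Y m\<close> for \<open>\<mu> m\<close> such that, for every \<open>\<nu>\<close>, those with
  \<open>\<mu> m = \<nu>\<close> form a basis of the eigenspace of \<open>\<nu>\<close> (the unique \<open>a\<close> is the coordinate vector
  of \<open>u\<close>). No order is prescribed.\<close>

definition spherical_harmonics :: "(nat \<Rightarrow> real) \<Rightarrow> (nat \<Rightarrow> real^'n::finite \<Rightarrow> real) \<Rightarrow> bool" where
  "spherical_harmonics \<mu> Y \<longleftrightarrow>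
     (\<forall>m. Y m \<in> sphere_eigenspace (\<mu> m)) \<and>
     (\<forall>\<nu>. \<forall>u \<in> sphere_eigenspace \<nu>. \<exists>!a :: nat \<Rightarrow> real.
        finite {m. a m \<noteq> 0} \<and> (\<forall>m. a m \<noteq> 0 \<longrightarrow> \<mu> m = \<nu>) \<and>
        (\<forall>x\<in>sphere 0 1. u x = (\<Sum>m | a m \<noteq> 0. a m * Y m x)))"

definition Lambda_const :: "nat \<Rightarrow> real \<Rightarrow> real" where
  "Lambda_const n \<gamma> =
     2 powr (2*\<gamma>) * (Gamma ((real n + 2*\<gamma>) / 4) / Gamma ((real n - 2*\<gamma>) / 4))\<^sup>2"

definition A_coef :: "nat \<Rightarrow> real \<Rightarrow> real \<Rightarrow> real" where
  "A_coef n \<gamma> \<nu> = 1/2 + \<gamma>/2 + 1/2 * sqrt ((real n / 2 - 1)\<^sup>2 + \<nu>)"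

definition B_coef :: "nat \<Rightarrow> real \<Rightarrow> real \<Rightarrow> real" where
  "B_coef n \<gamma> \<nu> = 1/2 - \<gamma>/2 + 1/2 * sqrt ((real n / 2 - 1)\<^sup>2 + \<nu>)"

text \<open>The symbol for the eigenvalue \<open>\<nu>\<close>, as a meromorphic function. At its poles the
  conventions of HOL give it an irrelevant value.\<close>

definition Theta :: "nat \<Rightarrow> real \<Rightarrow> real \<Rightarrow> complex \<Rightarrow> complex" where
  "Theta n \<gamma> \<nu> z = of_real (2 powr (2*\<gamma>)) *
     (Gamma (of_real (A_coef n \<gamma> \<nu>) + z * \<i> / 2) * Gamma (of_real (A_coef n \<gamma> \<nu>) - z * \<i> / 2)) /
     (Gamma (of_real (B_coef n \<gamma> \<nu>) + z * \<i> / 2) * Gamma (of_real (B_coef n \<gamma> \<nu>) - z * \<i> / 2))"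

text \<open>The poles of \<open>1 / (\<Theta> - \<kappa>)\<close> are the points \<open>\<plusminus> \<tau> j \<plusminus> i \<sigma> j\<close>, enumerated without repetition.\<close>

definition pole_enumeration ::
    "(complex \<Rightarrow> complex) \<Rightarrow> real \<Rightarrow> (nat \<Rightarrow> real) \<Rightarrow> (nat \<Rightarrow> real) \<Rightarrow> bool" where
  "pole_enumeration \<Theta> \<kappa> \<sigma> \<tau> \<longleftrightarrow>
     {z. is_pole (\<lambda>z. 1 / (\<Theta> z - of_real \<kappa>)) z} =
       (\<Union>j. {Complex (\<tau> j) (\<sigma> j), Complex (\<tau> j) (- \<sigma> j),
             Complex (- \<tau> j) (\<sigma> j), Complex (- \<tau> j) (- \<sigma> j)}) \<and>
     inj (\<lambda>j. (\<tau> j, \<sigma> j)) \<and>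
     \<tau> 0 = 0 \<and> (\<forall>j. \<tau> j \<ge> 0) \<and> (\<forall>\<^sub>F j in sequentially. \<tau> j = 0) \<and>
     \<sigma> 0 > 0 \<and> (\<forall>j\<ge>1. \<sigma> j > \<sigma> 0)"

definition conv :: "(real \<Rightarrow> real) \<Rightarrow> (real \<Rightarrow> real) \<Rightarrow> real \<Rightarrow> real" where
  "conv G h t = (LINT s|lborel. G (t - s) * h s)"

definition exp_decay :: "real \<Rightarrow> real \<Rightarrow> (real \<Rightarrow> real) \<Rightarrow> bool" where
  "exp_decay \<delta> \<delta>0 h \<longleftrightarrow>
     h \<in> O[at_top](\<lambda>t. exp (- \<delta> * t)) \<and> h \<in> O[at_bot](\<lambda>t. exp (\<delta>0 * t))"

definition fourier :: "(real \<Rightarrow> real) \<Rightarrow> real \<Rightarrow> complex" where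
  "fourier f \<xi> = (LINT t|lborel. exp (- (\<i> * of_real (\<xi> * t))) * of_real (f t))"

definition multiplier_image ::
    "(real \<Rightarrow> complex) \<Rightarrow> (real \<Rightarrow> real) \<Rightarrow> (real \<Rightarrow> real) \<Rightarrow> bool" where
  "multiplier_image M w g \<longleftrightarrow> integrable lborel w \<and> integrable lborel g \<and>
     (\<forall>\<xi>. fourier g \<xi> = M \<xi> * fourier w \<xi>)"

text \<open>\<open>G\<close> is the Green function of \<open>P - \<kappa>\<close>, where \<open>P\<close> is the multiplier with symbol \<open>\<Theta>\<close>: for
  \<open>w = G * h\<close> one has \<open>P w = \<kappa> w + h\<close>. Only integrable \<open>h\<close> are tested, for which the
  Fourier transforms of \<open>h\<close> and \<open>w\<close> are ordinary integrals; this determines \<open>G\<close>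
  almost everywhere.\<close>

definition green_function :: "(complex \<Rightarrow> complex) \<Rightarrow> real \<Rightarrow> (real \<Rightarrow> real) \<Rightarrow> bool" where
  "green_function \<Theta> \<kappa> G \<longleftrightarrow> integrable lborel G \<and>
     (\<forall>h \<epsilon> \<epsilon>0. continuous_on UNIV h \<and> \<epsilon> > 0 \<and> \<epsilon>0 > 0 \<and> exp_decay \<epsilon> \<epsilon>0 h \<longrightarrow>
        multiplier_image (\<lambda>\<xi>. \<Theta> (of_real \<xi>)) (conv G h) (\<lambda>t. \<kappa> * conv G h t + h t))"

definition green_term ::
    "(nat \<Rightarrow> real) \<Rightarrow> (nat \<Rightarrow> real) \<Rightarrow> (nat \<Rightarrow> real) \<Rightarrow> (nat \<Rightarrow> real) \<Rightarrow> real \<Rightarrow> nat \<Rightarrow> real" where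
  "green_term \<sigma> \<tau> c c' t j =
     exp (- \<sigma> j * \<bar>t\<bar>) * (c j * cos (\<tau> j * \<bar>t\<bar>) + c' j * sin (\<tau> j * \<bar>t\<bar>))"

text \<open>The value at \<open>t = 0\<close>, where the series may diverge, is irrelevant.\<close>

definition green_series ::
    "(nat \<Rightarrow> real) \<Rightarrow> (nat \<Rightarrow> real) \<Rightarrow> (nat \<Rightarrow> real) \<Rightarrow> (nat \<Rightarrow> real) \<Rightarrow> real \<Rightarrow> real" where
  "green_series \<sigma> \<tau> c c' t =
     c 0 * exp (- \<sigma> 0 * \<bar>t\<bar>) + (\<Sum>j. green_term \<sigma> \<tau> c c' t (Suc j))"

definition green_coefficients ::
    "(complex \<Rightarrow> complex) \<Rightarrow> real \<Rightarrow> (nat \<Rightarrow> real) \<Rightarrow> (nat \<Rightarrow> real) \<Rightarrow>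
     (nat \<Rightarrow> real) \<Rightarrow> (nat \<Rightarrow> real) \<Rightarrow> bool" where
  "green_coefficients \<Theta> \<kappa> \<sigma> \<tau> c c' \<longleftrightarrow>
     (\<forall>t. t \<noteq> 0 \<longrightarrow> summable (\<lambda>j. green_term \<sigma> \<tau> c c' t (Suc j))) \<and>
     green_function \<Theta> \<kappa> (green_series \<sigma> \<tau> c c')"

end

theory Submission
  imports Defs
begin

text \<open>
  The point is that all coefficients \<open>c j\<close> are nonnegative. The symbol on the imaginary axis is a
  limit of rational functions of \<open>z\<^sup>2\<close> whose zeros and poles interlace, because \<open>A - B = \<gamma>\<close> lies
  between 0 and 1; partial fractions show that \<open>\<Theta>(i s)\<close> decreases in \<open>s > 0\<close> between consecutive
  poles. Hence each such interval contains at most one \<open>\<sigma> j\<close>, so the \<open>\<sigma> j\<close> grow at least linearly,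
  and \<open>\<Theta> - \<kappa>\<close> is negative just to the right of \<open>\<sigma> j\<close>. The Fourier transform of the Green function
  equals \<open>1 / (\<Theta> - \<kappa>)\<close> on the real line and, by analytic continuation, near \<open>i \<sigma> j\<close>, where its
  residue is a multiple of \<open>c j\<close>; the sign of \<open>\<Theta> - \<kappa>\<close> then gives \<open>c j \<ge> 0\<close>. Integrability of
  the Green function now yields \<open>\<Sum> c j / \<sigma> j < \<infinity>\<close> by monotone convergence, and this dominates the
  series of the convolutions.
\<close>

section \<open>Interlacing products and quotients of Gamma functions\<close>

text \<open>Termwise convolution needs absolute convergence of \<Sum> c j / \<sigma> j, and
  convergence of the series at each t \<noteq> 0 does not give it: the series may diverge at 0.
  Integrability of the sum bounds the single terms only if they cannot cancel, which is why signs
  matter. The sign argument itself has to start from weak information: convergence at t = 1/2 bounds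
  c j exp (- \<sigma> j / 2), and the growth of \<sigma> j turns this into a dominated tail for |t|
  \<ge> 1. Once the finitely many slow exponentials are subtracted, the remainder decays so fast
  that its Fourier integral is holomorphic in a disc containing i \<sigma> j; the continuation takes
  place there. Monotonicity survives the limit of the products only as a weak inequality; strictness
  to the right of \<sigma> j comes from the pole of 1 / (\<Theta> - \<kappa>), near which \<Theta> =
  \<kappa> is impossible. The differential equations are separate from the signs: each kernel is
  split at s = t.\<close>

lemma interlacing_partial_fractions:
  fixes a b :: "nat \<Rightarrow> real"
  assumes ba: "\<And>k. b k < a k" and ab: "\<And>k l. k < l \<Longrightarrow> a k < b l"
  shows "\<exists>r. (\<forall>k<N. r k > 0) \<and> (\<forall>u. (\<forall>k<N. u \<noteq> a k) \<longrightarrow>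
           (\<Prod>k<N. (b k - u) / (a k - u)) = 1 - (\<Sum>k<N. r k / (a k - u)))"
proof (induction N)
  case 0
  show ?case by simp
next
  case (Suc N)
  then obtain r where r: "\<And>k. k < N \<Longrightarrow> r k > 0"
    and eq: "\<And>u. (\<forall>k<N. u \<noteq> a k) \<Longrightarrow>
        (\<Prod>k<N. (b k - u) / (a k - u)) = 1 - (\<Sum>k<N. r k / (a k - u))" by blast
  define P where "P = (\<Prod>k<N. (b k - a N) / (a k - a N))"
  define d where "d = a N - b N"
  \<comment> \<open>Multiplying by the new factor multiplies each old residue by the value of that
    factor at \<open>a k\<close>, a quotient of positive numbers. The new residue is
    \<open>d\<close> times the old product at \<open>a N\<close>, where every factor is a quotient
    of negative numbers.\<close>
  define r' where "r' k = (if k < N then r k * (b N - a k) / (a N - a k) else d * P)" for k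
  have aN: "a k < a N" if "k < N" for k using ab[OF that] ba[of N] by linarith
  have "P > 0" unfolding P_def
  proof (rule prod_pos, safe)
    fix k assume "k < N"
    thus "(b k - a N) / (a k - a N) > 0"
      using aN[of k] ba[of k] by (intro divide_neg_neg) auto
  qed
  have "d > 0" using ba[of N] by (simp add: d_def)
  have "r' k > 0" if "k < Suc N" for k
    using that r[of k] ab[of k N] aN[of k] \<open>P > 0\<close> \<open>d > 0\<close> by (auto simp: r'_def)
  moreover have "(\<Prod>k<Suc N. (b k - u) / (a k - u)) = 1 - (\<Sum>k<Suc N. r' k / (a k - u))"
    if u: "\<forall>k<Suc N. u \<noteq> a k" for u
  proof -
    have uN: "a N - u \<noteq> 0" using u by force
    have uk: "a k - u \<noteq> 0" if "k < N" for k
      using u[rule_format, of k] that by simp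
    define q where "q = d / (a N - u)"
    define R where "R = (\<Sum>k<N. r k / (a k - u))"
    have P: "P = 1 - (\<Sum>k<N. r k / (a k - a N))"
      unfolding P_def using aN by (intro eq) force
    have "(\<Sum>k<N. r' k / (a k - u)) =
        (\<Sum>k<N. r k / (a k - u) - d / (a N - u) * (r k / (a k - u)) + d / (a N - u) * (r k / (a k - a N)))"
    proof (rule sum.cong)
      fix k assume "k \<in> {..<N}"
      hence "k < N" by simp
      have "x * (z - d - y) / (z - y) / (y - u) =
          x / (y - u) - d / (z - u) * (x / (y - u)) + d / (z - u) * (x / (y - z))"
        if "z - u \<noteq> 0" "y - u \<noteq> 0" "y \<noteq> z" for x y z
      proof -
        have "x / (y - z) = - (x / (z - y))" by (metis minus_diff_eq divide_minus_right)
        moreover have "z - y \<noteq> 0" using that by simp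
        ultimately show ?thesis using that by (simp add: divide_simps) (simp add: algebra_simps)
      qed
      from this[OF uN uk[OF \<open>k < N\<close>], of "r k"] aN[OF \<open>k < N\<close>]
      show "r' k / (a k - u) = r k / (a k - u) - d / (a N - u) * (r k / (a k - u))
          + d / (a N - u) * (r k / (a k - a N))"
        using \<open>k < N\<close> by (simp add: r'_def d_def)
    qed simp
    also have "\<dots> = R * (1 - q) + q * (1 - P)"
      unfolding sum.distrib sum_subtractf sum_distrib_left[symmetric] P R_def[symmetric] q_def[symmetric]
      by (simp add: algebra_simps)
    finally have S: "(\<Sum>k<N. r' k / (a k - u)) = R * (1 - q) + q * (1 - P)" .
    have "(b N - u) / (a N - u) = 1 - q"
      using uN by (simp add: d_def q_def field_simps)
    moreover have "(\<Prod>k<N. (b k - u) / (a k - u)) = 1 - R"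
      unfolding R_def using u by (intro eq) auto
    moreover have "r' N / (a N - u) = q * P" by (simp add: r'_def q_def)
    ultimately have "(\<Prod>k<Suc N. (b k - u) / (a k - u)) = (1 - R) * (1 - q)"
      and "(\<Sum>k<Suc N. r' k / (a k - u)) = R * (1 - q) + q * (1 - P) + q * P"
      using S by simp_all
    thus ?thesis by (simp only: algebra_simps)
  qed
  ultimately show ?case by blast
qed

text \<open>A term \<open>r k / (a k - u)\<close> with \<open>r k > 0\<close> increases in u on
  either side of its pole, and \<open>gap\<close> puts u and v on the same side of every
  \<open>a k\<close>.\<close>

lemma interlacing_prod_antimono:
  fixes a b :: "nat \<Rightarrow> real"
  assumes ba: "\<And>k. b k < a k" and ab: "\<And>k l. k < l \<Longrightarrow> a k < b l"
    and "u \<le> v" and gap: "\<And>k. k < N \<Longrightarrow> a k < u \<or> v < a k"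
  shows "(\<Prod>k<N. (b k - v) / (a k - v)) \<le> (\<Prod>k<N. (b k - u) / (a k - u))"
proof -
  have "\<exists>r. (\<forall>k<N. r k > 0) \<and> (\<forall>u. (\<forall>k<N. u \<noteq> a k) \<longrightarrow>
        (\<Prod>k<N. (b k - u) / (a k - u)) = 1 - (\<Sum>k<N. r k / (a k - u)))"
    by (rule interlacing_partial_fractions) (fact ba ab)+
  then obtain r where "\<forall>k<N. r k > 0" and eq: "\<forall>u. (\<forall>k<N. u \<noteq> a k) \<longrightarrow>
        (\<Prod>k<N. (b k - u) / (a k - u)) = 1 - (\<Sum>k<N. r k / (a k - u))"
    by (elim exE conjE)
  hence r: "r k > 0" if "k < N" for k using that by blast
  have "r k / (a k - u) \<le> r k / (a k - v)" if "k < N" for k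
  proof -
    have "inverse (a k - u) \<le> inverse (a k - v)"
    proof (cases "a k < u")
      case True
      thus ?thesis using \<open>u \<le> v\<close> by (intro le_imp_inverse_le_neg) auto
    next
      case False
      thus ?thesis using gap[OF that] \<open>u \<le> v\<close> by (intro le_imp_inverse_le) auto
    qed
    thus ?thesis using r[OF that] by (simp add: divide_inverse mult_left_mono)
  qed
  hence "(\<Sum>k<N. r k / (a k - u)) \<le> (\<Sum>k<N. r k / (a k - v))"
    by (intro sum_mono) simp
  moreover have "u \<noteq> a k \<and> v \<noteq> a k" if "k < N" for k
    using gap[OF that] \<open>u \<le> v\<close> by auto
  ultimately show ?thesis by (simp add: eq)
qed

section \<open>Quotients of Gamma functions as limits of interlacing products\<close>

text \<open>At \<open>x = s / 2\<close> this is the symbol at i s, up to the factor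
  \<open>2 powr (2*\<gamma>)\<close>. Reciprocal Gamma functions are entire, so poles come only from
  zeros of the denominator.\<close>

definition Gamma_quot :: "real \<Rightarrow> real \<Rightarrow> real \<Rightarrow> real" where
  "Gamma_quot A B x = rGamma (B - x) * rGamma (B + x) / (rGamma (A - x) * rGamma (A + x))"

text \<open>Pairing \<open>a - x\<close> with \<open>a + x\<close> leaves a function of the square
  of x, which is the variable u of the interlacing products.\<close>

lemma pochhammer_pair:
  fixes a x :: real
  shows "pochhammer (a - x) n * pochhammer (a + x) n = (\<Prod>k<n. (a + real k)\<^sup>2 - x\<^sup>2)"
  unfolding pochhammer_prod prod.distrib[symmetric] atLeast0LessThan
  by (rule prod.cong) (simp_all add: power2_eq_square algebra_simps)

lemma rGamma_real_eq_0_iff: "rGamma (x::real) = 0 \<longleftrightarrow> (\<exists>k. x = - real k)"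
  by (auto simp: rGamma_eq_zero_iff elim!: nonpos_Ints_cases')

text \<open>Gauss's product for the reciprocal Gamma function. The powers of n with exponents x and
  - x cancel in each pair and the factorials cancel in the quotient; only n to the power 2 (A - B)
  remains.\<close>

lemma Gamma_quot_LIMSEQ:
  assumes "rGamma (A - x) * rGamma (A + x) \<noteq> 0"
  shows "(\<lambda>n. exp (2 * (A - B) * ln (real n)) *
            (\<Prod>k<Suc n. ((B + real k)\<^sup>2 - x\<^sup>2) / ((A + real k)\<^sup>2 - x\<^sup>2))) \<longlonglongrightarrow> Gamma_quot A B x"
proof -
  have "(\<lambda>n. rGamma_series (B - x) n * rGamma_series (B + x) n /
           (rGamma_series (A - x) n * rGamma_series (A + x) n)) \<longlonglongrightarrow> Gamma_quot A B x"
    unfolding Gamma_quot_def using assms by (intro tendsto_intros rGamma_series_LIMSEQ)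
  moreover have "rGamma_series (B - x) n * rGamma_series (B + x) n /
      (rGamma_series (A - x) n * rGamma_series (A + x) n) = exp (2 * (A - B) * ln (real n)) *
            (\<Prod>k<Suc n. ((B + real k)\<^sup>2 - x\<^sup>2) / ((A + real k)\<^sup>2 - x\<^sup>2))" for n
  proof -
    have s: "rGamma_series (a - x) n * rGamma_series (a + x) n =
        (\<Prod>k<Suc n. (a + real k)\<^sup>2 - x\<^sup>2) / ((fact n)\<^sup>2 * exp (2 * a * ln (real n)))" for a
    proof -
      have "exp ((a - x) * ln (real n)) * exp ((a + x) * ln (real n)) = exp (2 * a * ln (real n))"
        by (simp add: exp_add[symmetric] algebra_simps)
      thus ?thesis
        unfolding rGamma_series_def pochhammer_pair[symmetric]
        by (simp add: power2_eq_square mult_ac del: prod.lessThan_Suc)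
    qed
    have "exp (2 * (A - B) * ln (real n)) = exp (2 * A * ln (real n)) / exp (2 * B * ln (real n))"
      by (simp add: exp_diff[symmetric] algebra_simps)
    thus ?thesis unfolding s prod_dividef
      by (simp del: prod.lessThan_Suc)
  qed
  ultimately show ?thesis by simp
qed

text \<open>The prefactor of the finite products does not involve x, so their monotonicity passes to
  the limit. Convergence at both ends requires nonzero denominators: \<open>gap\<close> excludes the
  zeros from \<open>A - z\<close>, and positivity of \<open>A + z\<close> the others.\<close>

lemma Gamma_quot_antimono:
  assumes "0 < B" "B < A" "A < B + 1" and "0 \<le> x" "x \<le> y"
    and gap: "\<And>k. A + real k < x \<or> y < A + real k"
  shows "Gamma_quot A B y \<le> Gamma_quot A B x"
proof -
  have nz: "rGamma (A - z) * rGamma (A + z) \<noteq> 0" if "x \<le> z" "z \<le> y" for z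
  proof -
    have "A - z \<noteq> - real k \<and> A + z \<noteq> - real k" for k
      using gap[of k] that assms(1,2,4) by auto
    thus ?thesis by (simp add: rGamma_real_eq_0_iff)
  qed
  show ?thesis
  proof (rule LIMSEQ_le[OF Gamma_quot_LIMSEQ[OF nz] Gamma_quot_LIMSEQ[OF nz]])
    have "(\<Prod>k<Suc n. ((B + real k)\<^sup>2 - y\<^sup>2) / ((A + real k)\<^sup>2 - y\<^sup>2))
        \<le> (\<Prod>k<Suc n. ((B + real k)\<^sup>2 - x\<^sup>2) / ((A + real k)\<^sup>2 - x\<^sup>2))" for n
    proof (rule interlacing_prod_antimono)
      show "(B + real k)\<^sup>2 < (A + real k)\<^sup>2" for k
        using assms by (intro power_strict_mono) auto
      show "(A + real k)\<^sup>2 < (B + real l)\<^sup>2" if "k < l" for k l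
      proof -
        have "real k + 1 \<le> real l" using that by linarith
        thus ?thesis using assms by (intro power_strict_mono) auto
      qed
      show "x\<^sup>2 \<le> y\<^sup>2" using assms by (intro power_mono) auto
      show "(A + real k)\<^sup>2 < x\<^sup>2 \<or> y\<^sup>2 < (A + real k)\<^sup>2" for k
        proof (cases "A + real k < x")
          case True
          hence "(A + real k)\<^sup>2 < x\<^sup>2" using assms by (intro power_strict_mono) auto
          thus ?thesis ..
        next
          case False
          hence "y\<^sup>2 < (A + real k)\<^sup>2"
            using gap[of k] assms by (intro power_strict_mono) auto
          thus ?thesis ..
        qed
    qed
    thus "\<exists>N. \<forall>n\<ge>N. exp (2 * (A - B) * ln (real n)) *
            (\<Prod>k<Suc n. ((B + real k)\<^sup>2 - y\<^sup>2) / ((A + real k)\<^sup>2 - y\<^sup>2)) \<le>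
         exp (2 * (A - B) * ln (real n)) *
            (\<Prod>k<Suc n. ((B + real k)\<^sup>2 - x\<^sup>2) / ((A + real k)\<^sup>2 - x\<^sup>2))"
      by (intro exI[of _ 0] allI impI mult_left_mono) auto
  qed (use assms in auto)
qed

section \<open>Eigenvalues of the sphere\<close>

text \<open>If L were positive, \<phi>' would be positive just to the right of its zero at 0, and
  the mean value theorem would give a value of \<phi> above \<phi> 0.\<close>

lemma second_derivative_nonpos_at_max:
  fixes \<phi> \<phi>' :: "real \<Rightarrow> real"
  assumes "r > 0" and max: "\<And>s. \<bar>s\<bar> < r \<Longrightarrow> \<phi> s \<le> \<phi> 0"
    and D: "\<And>s. \<bar>s\<bar> < r \<Longrightarrow> (\<phi> has_real_derivative \<phi>' s) (at s)"
    and D2: "(\<phi>' has_real_derivative L) (at 0)"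
  shows "L \<le> 0"
proof (rule ccontr)
  assume "\<not> L \<le> 0"
  have "\<phi>' 0 = 0"
    using DERIV_local_max[OF D[of 0], of r] max \<open>r > 0\<close> by (auto simp: abs_minus_commute)
  obtain d where "d > 0" and d: "\<And>s. 0 < s \<Longrightarrow> s < d \<Longrightarrow> \<phi>' s > 0"
    using DERIV_pos_inc_right[OF D2] \<open>\<not> L \<le> 0\<close> \<open>\<phi>' 0 = 0\<close> by fastforce
  define s where "s = min d r / 2"
  have s: "0 < s" "s < d" "s < r" using \<open>d > 0\<close> \<open>r > 0\<close> by (auto simp: s_def)
  have "\<exists>z. 0 < z \<and> z < s \<and> \<phi> s - \<phi> 0 = (s - 0) * \<phi>' z"
    by (rule MVT2) (use s D in auto)
  then obtain z where z: "0 < z" "z < s" "\<phi> s - \<phi> 0 = s * \<phi>' z" by auto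
  hence "\<phi> s - \<phi> 0 > 0" using s d[of z] by simp
  thus False using max[of s] s by simp
qed

lemma partial_has_real_derivative:
  assumes "(\<lambda>s. f (x + s *\<^sub>R axis i 1)) differentiable (at 0)"
  shows "((\<lambda>s. f (x + s *\<^sub>R axis i 1)) has_real_derivative partial i f x) (at 0)"
  using assms unfolding partial_def
  by (simp add: DERIV_deriv_iff_real_differentiable)

lemma partial_has_real_derivative_at:
  assumes "(\<lambda>s. f ((x + s0 *\<^sub>R axis i 1) + s *\<^sub>R axis i 1)) differentiable (at 0)"
  shows "((\<lambda>s. f (x + s *\<^sub>R axis i 1)) has_real_derivative partial i f (x + s0 *\<^sub>R axis i 1)) (at s0)"
  using partial_has_real_derivative[OF assms]
    DERIV_shift[of "\<lambda>s. f (x + s *\<^sub>R axis i 1)" "partial i f (x + s0 *\<^sub>R axis i 1)" 0 s0]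
  by (simp add: algebra_simps)

lemma laplacian_nonpos_at_max:
  fixes f :: "real^'n::finite \<Rightarrow> real"
  assumes "Ck_on 2 f S" "open S" "p \<in> S" and max: "\<And>x. x \<in> S \<Longrightarrow> f x \<le> f p"
  shows "laplacian f p \<le> 0"
  unfolding laplacian_def
proof (rule sum_nonpos)
  fix i :: 'n
  obtain r where "r > 0" and r: "ball p r \<subseteq> S"
    using assms(2,3) openE by blast
  have in_S: "p + s *\<^sub>R axis i 1 \<in> S" if "\<bar>s\<bar> < r" for s
    using r that by (auto simp: dist_norm)
  show "partial i (partial i f) p \<le> 0"
  proof (rule second_derivative_nonpos_at_max)
    show "f (p + s *\<^sub>R axis i 1) \<le> f (p + 0 *\<^sub>R axis i 1)" if "\<bar>s\<bar> < r" for s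
      using max[OF in_S[OF that]] by simp
    show "((\<lambda>s. f (p + s *\<^sub>R axis i 1)) has_real_derivative partial i f (p + s *\<^sub>R axis i 1)) (at s)"
      if "\<bar>s\<bar> < r" for s
      using assms(1) in_S[OF that] by (intro partial_has_real_derivative_at) (simp add: numeral_2_eq_2)
    show "((\<lambda>s. partial i f (p + s *\<^sub>R axis i 1)) has_real_derivative partial i (partial i f) p) (at 0)"
      using assms(1,3) by (intro partial_has_real_derivative) (simp add: numeral_2_eq_2)
  qed fact
qed

lemma laplacian_nonneg_at_min:
  fixes f :: "real^'n::finite \<Rightarrow> real"
  assumes "Ck_on 2 f S" "open S" "p \<in> S" and min: "\<And>x. x \<in> S \<Longrightarrow> f p \<le> f x"
  shows "laplacian f p \<ge> 0"
  unfolding laplacian_def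
proof (rule sum_nonneg)
  fix i :: 'n
  obtain r where "r > 0" and r: "ball p r \<subseteq> S"
    using assms(2,3) openE by blast
  have in_S: "p + s *\<^sub>R axis i 1 \<in> S" if "\<bar>s\<bar> < r" for s
    using r that by (auto simp: dist_norm)
  have "- partial i (partial i f) p \<le> 0"
  proof (rule second_derivative_nonpos_at_max)
    show "- f (p + s *\<^sub>R axis i 1) \<le> - f (p + 0 *\<^sub>R axis i 1)" if "\<bar>s\<bar> < r" for s
      using min[OF in_S[OF that]] by simp
    show "((\<lambda>s. - f (p + s *\<^sub>R axis i 1)) has_real_derivative - partial i f (p + s *\<^sub>R axis i 1)) (at s)"
      if "\<bar>s\<bar> < r" for s
      using assms(1) in_S[OF that]
      by (intro DERIV_minus partial_has_real_derivative_at) (simp add: numeral_2_eq_2)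
    show "((\<lambda>s. - partial i f (p + s *\<^sub>R axis i 1)) has_real_derivative - partial i (partial i f) p) (at 0)"
      using assms(1,3) by (intro DERIV_minus partial_has_real_derivative) (simp add: numeral_2_eq_2)
  qed fact
  thus "partial i (partial i f) p \<ge> 0" by simp
qed

text \<open>Maximum principle: no integration by parts on the sphere is needed.\<close>

lemma sphere_eigenvalue_nonneg:
  assumes u: "u \<in> sphere_eigenspace \<nu>" and nz: "\<exists>x\<in>sphere 0 1. u x \<noteq> 0"
  shows "\<nu> \<ge> 0"
proof -
  let ?f = "radial_ext u"
  have C: "Ck_on 2 ?f (- {0})" and eig: "\<And>x. x \<in> sphere 0 1 \<Longrightarrow> - laplacian ?f x = \<nu> * u x"
    using u by (auto simp: sphere_eigenspace_def)
  have on_sphere: "?f x = u x" if "x \<in> sphere 0 1" for x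
    using that by (simp add: radial_ext_def)
  have proj: "x /\<^sub>R norm x \<in> sphere 0 1" if "x \<noteq> 0" for x :: "real^'a"
    using that by simp
  have ne: "sphere (0::real^'a) 1 \<noteq> {}" using nz by blast
  have "continuous_on (- {0}) ?f" using C by (simp add: numeral_2_eq_2)
  hence "continuous_on (sphere 0 1) ?f" by (rule continuous_on_subset) auto
  hence cont: "continuous_on (sphere 0 1) u"
    by (rule continuous_on_eq) (use on_sphere in auto)
  obtain x where x: "x \<in> sphere 0 1" "u x \<noteq> 0" using nz by blast
  show ?thesis
  \<comment> \<open>Either u has a positive maximum or, being nonzero somewhere, a negative minimum.
    At such a point the sign of the Laplacian, compared with \<nu> u, forces \<nu> \<ge> 0.\<close>
  proof (cases "u x > 0")
    case True
    obtain p where p: "p \<in> sphere 0 1" "\<And>y. y \<in> sphere 0 1 \<Longrightarrow> u y \<le> u p"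
      using continuous_attains_sup[OF compact_sphere ne cont] by blast
    have "laplacian ?f p \<le> 0"
    \<comment> \<open>The extension is constant along rays, so a maximum over the sphere is a
      maximum over the whole punctured space.\<close>
    proof (rule laplacian_nonpos_at_max[OF C])
      show "?f y \<le> ?f p" if "y \<in> - {0}" for y
        using that p(2)[OF proj[of y]] on_sphere[OF p(1)] by (simp add: radial_ext_def)
    qed (use p in auto)
    hence "\<nu> * u p \<ge> 0" using eig[OF p(1)] by simp
    moreover have "u p > 0" using p(2)[OF x(1)] True by simp
    ultimately show ?thesis by (simp add: zero_le_mult_iff)
  next
    case False
    obtain p where p: "p \<in> sphere 0 1" "\<And>y. y \<in> sphere 0 1 \<Longrightarrow> u p \<le> u y"
      using continuous_attains_inf[OF compact_sphere ne cont] by blast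
    have "laplacian ?f p \<ge> 0"
    proof (rule laplacian_nonneg_at_min[OF C])
      show "?f p \<le> ?f y" if "y \<in> - {0}" for y
        using that p(2)[OF proj[of y]] on_sphere[OF p(1)] by (simp add: radial_ext_def)
    qed (use p in auto)
    hence "\<nu> * u p \<le> 0" using eig[OF p(1)] by simp
    moreover have "u p < 0" using p(2)[OF x(1)] False x(2) by simp
    ultimately show ?thesis by (simp add: mult_le_0_iff)
  qed
qed

text \<open>If \<open>Y m\<close> vanished on the sphere, both the zero vector and the m-th unit
  vector would be its coordinates, against uniqueness. The inequality is what makes
  \<open>B_coef\<close> positive.\<close>

lemma spherical_harmonics_eigenvalue_nonneg:
  assumes "spherical_harmonics \<mu> Y"
  shows "\<mu> m \<ge> 0"
proof (rule sphere_eigenvalue_nonneg)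
  show Ym: "Y m \<in> sphere_eigenspace (\<mu> m)"
    using assms by (simp add: spherical_harmonics_def)
  show "\<exists>x\<in>sphere 0 1. Y m x \<noteq> 0"
  proof (rule ccontr)
    assume zero: "\<not> ?thesis"
    define rep where "rep a \<longleftrightarrow> finite {k. a k \<noteq> 0} \<and> (\<forall>k. a k \<noteq> 0 \<longrightarrow> \<mu> k = \<mu> m) \<and>
        (\<forall>x\<in>sphere 0 1. Y m x = (\<Sum>k | a k \<noteq> 0. a k * Y k x))" for a :: "nat \<Rightarrow> real"
    have "\<exists>!a. rep a" using assms Ym unfolding spherical_harmonics_def rep_def by blast
    moreover have "rep (\<lambda>_. 0)" using zero by (simp add: rep_def)
    moreover have "rep (\<lambda>k. if k = m then 1 else 0)" by (simp add: rep_def)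
    ultimately have "(\<lambda>_. 0) = (\<lambda>k. if k = m then 1 else 0 :: real)" by metis
    thus False by (metis zero_neq_one)
  qed
qed

section \<open>Fourier transforms\<close>

text \<open>The fundamental theorem is used twice: for the real exponent \<open>Re a\<close>, where
  nonnegativity yields integrability of the norm, and then for the complex antiderivative, which
  yields the value.\<close>

lemma has_bochner_integral_exp_half_line:
  fixes a :: complex
  assumes "Re a > 0"
  shows "has_bochner_integral lborel (\<lambda>t. indicator {0<..} t *\<^sub>R exp (- (a * of_real t))) (1 / a)"
proof -
  have real: "set_integrable lborel (einterval 0 \<infinity>) (\<lambda>t. exp (- (Re a * t)))"
  proof (rule interval_integral_FTC_nonneg)
    show "((\<lambda>t. - exp (- (Re a * t)) / Re a) has_real_derivative exp (- (Re a * t))) (at t)" for t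
      using assms by (auto intro!: derivative_eq_intros)
    show "(((\<lambda>t. - exp (- (Re a * t)) / Re a) \<circ> real_of_ereal) \<longlongrightarrow> - 1 / Re a) (at_right 0)"
      unfolding zero_ereal_def ereal_tendsto_simps
      by (rule tendsto_eq_intros refl)+ (use assms in auto)
    show "(((\<lambda>t. - exp (- (Re a * t)) / Re a) \<circ> real_of_ereal) \<longlongrightarrow> 0) (at_left \<infinity>)"
      unfolding ereal_tendsto_simps using assms by real_asymp
  qed (auto intro!: continuous_intros)
  have int: "set_integrable lborel (einterval 0 \<infinity>) (\<lambda>t. exp (- (a * of_real t)))"
    unfolding set_integrable_def
    by (rule Bochner_Integration.integrable_bound[OF real[unfolded set_integrable_def]])
       (auto simp: norm_exp_eq_Re)
  have "(LBINT t=0..\<infinity>. exp (- (a * of_real t))) = 0 - (- 1 / a)"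
  proof (rule interval_integral_FTC_integrable[OF _ _ _ int])
    show "((\<lambda>t. - exp (- (a * of_real t)) / a) has_vector_derivative exp (- (a * of_real t))) (at t)" for t
    proof (rule has_vector_derivative_real_field)
      show "((\<lambda>z. - exp (- (a * z)) / a) has_field_derivative exp (- (a * of_real t))) (at (of_real t))"
        using assms by (auto intro!: derivative_eq_intros)
    qed
    show "(((\<lambda>t. - exp (- (a * of_real t)) / a) \<circ> real_of_ereal) \<longlongrightarrow> - 1 / a) (at_right 0)"
      unfolding zero_ereal_def ereal_tendsto_simps
      by (rule tendsto_eq_intros refl)+ (use assms in auto)
    have "((\<lambda>t. exp (- (Re a * t))) \<longlongrightarrow> 0) at_top" using assms by real_asymp
    hence "((\<lambda>t. exp (- (a * of_real t))) \<longlongrightarrow> 0) at_top"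
      by (subst tendsto_norm_zero_iff[symmetric]) (simp add: norm_exp_eq_Re)
    hence "((\<lambda>t. - exp (- (a * of_real t)) / a) \<longlongrightarrow> - 0 / a) at_top"
      using assms by (intro tendsto_intros) auto
    thus "(((\<lambda>t. - exp (- (a * of_real t)) / a) \<circ> real_of_ereal) \<longlongrightarrow> 0) (at_left \<infinity>)"
      unfolding ereal_tendsto_simps by simp
  qed (auto intro!: continuous_intros)
  hence "integral\<^sup>L lborel (\<lambda>t. indicator {0<..} t *\<^sub>R exp (- (a * of_real t))) = 1 / a"
    unfolding interval_lebesgue_integral_def set_lebesgue_integral_def
    by (simp add: zero_ereal_def)
  thus ?thesis
    using int by (simp add: has_bochner_integral_iff set_integrable_def zero_ereal_def)
qed

text \<open>With a = \<sigma> + i \<xi> the right half-line contributes \<open>1 / a\<close> and the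
  left one, after reflection, \<open>1 / cnj a\<close>. The two integrands agree with the original
  off t = 0.\<close>

lemma has_bochner_integral_fourier_exp_abs:
  fixes \<sigma> \<xi> :: real
  assumes "\<sigma> > 0"
  shows "has_bochner_integral lborel
           (\<lambda>t. exp (- (\<i> * of_real (\<xi> * t))) * of_real (exp (- \<sigma> * \<bar>t\<bar>)))
           (of_real (2 * \<sigma>) / (of_real \<sigma> ^ 2 + of_real \<xi> ^ 2))"
proof -
  define a where "a = Complex \<sigma> \<xi>"
  have a: "a = of_real \<sigma> + \<i> * of_real \<xi>" "cnj a = of_real \<sigma> - \<i> * of_real \<xi>"
    by (simp_all add: a_def complex_eq_iff)
  let ?f = "\<lambda>b t. indicator {0<..} t *\<^sub>R exp (- (b * of_real t)) :: complex"
  have "has_bochner_integral lborel (?f a) (1 / a)"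
    and "has_bochner_integral lborel (?f (cnj a)) (1 / cnj a)"
    using assms by (auto intro!: has_bochner_integral_exp_half_line simp: a_def)
  moreover from this(2) have "has_bochner_integral lborel (\<lambda>t. ?f (cnj a) (0 + (- 1) * t)) ((1 / cnj a) /\<^sub>R \<bar>- 1\<bar>)"
    by (subst (asm) lborel_has_bochner_integral_real_affine_iff[of "- 1" _ _ 0]) auto
  ultimately have "has_bochner_integral lborel (\<lambda>t. ?f a t + ?f (cnj a) (0 + (- 1) * t))
      (1 / a + (1 / cnj a) /\<^sub>R \<bar>- 1\<bar>)"
    by (intro has_bochner_integral_add)
  also have "1 / a + (1 / cnj a) /\<^sub>R \<bar>- 1\<bar> = of_real (2 * \<sigma>) / (of_real \<sigma> ^ 2 + of_real \<xi> ^ 2)"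
  proof -
    have "a \<noteq> 0" using assms by (simp add: a_def complex_eq_iff)
    moreover have "a * cnj a = of_real \<sigma> ^ 2 + of_real \<xi> ^ 2"
      unfolding a by (simp add: power2_eq_square algebra_simps)
    moreover have "1 / a + 1 / cnj a = (a + cnj a) / (a * cnj a)"
      using \<open>a \<noteq> 0\<close> by (simp add: divide_simps)
    moreover have "a + cnj a = of_real (2 * \<sigma>)" unfolding a by simp
    ultimately show ?thesis by simp
  qed
  also have "has_bochner_integral lborel (\<lambda>t. ?f a t + ?f (cnj a) (0 + (- 1) * t))
        (of_real (2 * \<sigma>) / (of_real \<sigma> ^ 2 + of_real \<xi> ^ 2)) \<longleftrightarrow> ?thesis"
  proof (rule has_bochner_integral_cong_AE)
    have "AE t in lborel. t \<noteq> (0::real)" by (rule AE_lborel_singleton)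
    thus "AE t in lborel. ?f a t + ?f (cnj a) (0 + (- 1) * t) =
        exp (- (\<i> * of_real (\<xi> * t))) * of_real (exp (- \<sigma> * \<bar>t\<bar>))"
    proof eventually_elim
      case (elim t)
      show ?case
      proof (cases "t > 0")
        case True
        thus ?thesis by (simp add: a algebra_simps mult_exp_exp flip: exp_of_real)
      next
        case False
        thus ?thesis using elim by (simp add: a algebra_simps mult_exp_exp flip: exp_of_real)
      qed
    qed
  qed measurable
  finally show ?thesis .
qed

lemma has_bochner_integral_exp_abs:
  fixes \<sigma> :: real
  assumes "\<sigma> > 0"
  shows "has_bochner_integral lborel (\<lambda>t. exp (- \<sigma> * \<bar>t\<bar>)) (2 / \<sigma>)"
proof -
  have *: "has_bochner_integral lborel (\<lambda>t. complex_of_real (exp (- \<sigma> * \<bar>t\<bar>))) (of_real (2 / \<sigma>))"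
    using has_bochner_integral_fourier_exp_abs[OF assms, of 0] assms by (simp add: power2_eq_square)
  show ?thesis
    using has_bochner_integral_Re[OF *] by simp
qed

text \<open>The exponential is expanded in powers of z and integrated term by term. For |z| < r all
  partial sums of the norms stay below |T t| exp (r |t|), which justifies the exchange and exhibits
  a power series converging on the disc.\<close>

lemma fourier_integral_holomorphic:
  fixes T :: "real \<Rightarrow> real"
  assumes [measurable]: "T \<in> borel_measurable borel"
    and int: "integrable lborel (\<lambda>t. \<bar>T t\<bar> * exp (r * \<bar>t\<bar>))"
  shows "(\<lambda>z. LINT t|lborel. exp (- (\<i> * (z * of_real t))) * of_real (T t)) holomorphic_on ball 0 r"
proof (rule power_series_holomorphic)
  fix z :: complex assume "z \<in> ball 0 r"
  hence z: "norm z < r" by simp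
  let ?c = "\<lambda>n t. (- (\<i> * of_real t)) ^ n / fact n * of_real (T t) :: complex"
  let ?f = "\<lambda>n t. ?c n t * z ^ n"
  have norm_f: "norm (?f n t) = (norm z * \<bar>t\<bar>) ^ n / fact n * \<bar>T t\<bar>" for n t
    by (simp add: norm_mult norm_power norm_divide power_mult_distrib)
  have exp_sums: "(\<lambda>n. norm (?f n t)) sums (exp (norm z * \<bar>t\<bar>) * \<bar>T t\<bar>)" for t
    unfolding norm_f using exp_converges[of "norm z * \<bar>t\<bar>"]
    by (intro sums_mult2) (simp add: field_simps)
  have exp_le: "exp (norm z * \<bar>t\<bar>) * \<bar>T t\<bar> \<le> \<bar>T t\<bar> * exp (r * \<bar>t\<bar>)" for t
  proof -
    have "norm z * \<bar>t\<bar> \<le> r * \<bar>t\<bar>" using z by (intro mult_right_mono) auto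
    thus ?thesis by (subst mult.commute) (intro mult_left_mono, auto)
  qed
  have partial: "(\<Sum>n<N. norm (?f n t)) \<le> \<bar>T t\<bar> * exp (r * \<bar>t\<bar>)" for N t
    using exp_le[of t] exp_sums[of t] sum_le_suminf[of "\<lambda>n. norm (?f n t)" "{..<N}"]
    by (simp add: sums_iff)
  have int_f: "integrable lborel (?f n)" for n
  proof (rule Bochner_Integration.integrable_bound[OF int])
    have "norm (?f n t) \<le> \<bar>T t\<bar> * exp (r * \<bar>t\<bar>)" for t
      using partial[of t "Suc n"] sum_nonneg[of "{..<n}" "\<lambda>n. norm (?f n t)"]
      unfolding sum.lessThan_Suc by (smt (verit) norm_ge_zero)
    thus "AE t in lborel. norm (?f n t) \<le> norm (\<bar>T t\<bar> * exp (r * \<bar>t\<bar>))" by simp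
  qed simp
  have "(\<lambda>n. integral\<^sup>L lborel (?f n)) sums (\<integral>t. (\<Sum>n. ?f n t) \<partial>lborel)"
  proof (rule sums_integral[OF int_f])
    show "AE t in lborel. summable (\<lambda>n. norm (?f n t))"
      using exp_sums by (auto simp: sums_iff)
    show "summable (\<lambda>n. \<integral>t. norm (?f n t) \<partial>lborel)"
    proof (rule summableI_nonneg_bounded)
      show "(\<Sum>n<N. \<integral>t. norm (?f n t) \<partial>lborel) \<le> (\<integral>t. \<bar>T t\<bar> * exp (r * \<bar>t\<bar>) \<partial>lborel)" for N
        unfolding Bochner_Integration.integral_sum[OF integrable_norm[OF int_f], symmetric]
        using partial by (intro integral_mono int Bochner_Integration.integrable_sum integrable_norm int_f)
    qed simp
  qed
  moreover have "(\<Sum>n. ?f n t) = exp (- (\<i> * (z * of_real t))) * of_real (T t)" for t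
  proof -
    have "(\<lambda>n. (- (\<i> * (z * of_real t))) ^ n /\<^sub>R fact n * of_real (T t)) sums
        (exp (- (\<i> * (z * of_real t))) * of_real (T t))"
      by (intro sums_mult2 exp_converges)
    moreover have "(- (\<i> * (z * of_real t))) ^ n /\<^sub>R fact n * of_real (T t) = ?f n t" for n
    proof -
      have "(- (\<i> * (z * of_real t))) ^ n = (- (\<i> * of_real t)) ^ n * z ^ n"
        by (simp add: power_mult_distrib[symmetric] algebra_simps)
      thus ?thesis by (simp add: scaleR_conv_of_real divide_inverse mult_ac)
    qed
    ultimately show ?thesis by (simp add: sums_iff)
  qed
  moreover have "integral\<^sup>L lborel (?f n) = (LINT t|lborel. ?c n t) * (z - 0) ^ n" for n
    by simp
  ultimately show "(\<lambda>n. (LINT t|lborel. ?c n t) * (z - 0) ^ n) sums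
      (LINT t|lborel. exp (- (\<i> * (z * of_real t))) * of_real (T t))"
    by simp
qed

section \<open>Convolutions and the transform of the Green function\<close>

lemma fourier_conv:
  fixes G h :: "real \<Rightarrow> real"
  assumes G: "integrable lborel G" and h: "integrable lborel h"
  shows "fourier (conv G h) \<xi> = fourier G \<xi> * fourier h \<xi>"
proof -
  have [measurable]: "G \<in> borel_measurable borel" "h \<in> borel_measurable borel"
    using G h by (auto dest: borel_measurable_integrable)
  define e where "e t = exp (- (\<i> * of_real (\<xi> * t)))" for t :: real
  have norm_e: "norm (e t) = 1" for t by (simp add: e_def norm_exp_eq_Re)
  have [measurable]: "e \<in> borel_measurable borel" unfolding e_def by measurable
  have shift: "integrable lborel (\<lambda>t. G (t - s))" "(LINT t|lborel. \<bar>G (t - s)\<bar>) = (LINT t|lborel. \<bar>G t\<bar>)"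
    for s
    using lborel_integrable_real_affine[OF G, of 1 "- s"]
      lborel_integral_real_affine[of 1 "\<lambda>t. \<bar>G t\<bar>" "- s"] by (simp_all add: algebra_simps)
  let ?f = "\<lambda>s t. of_real (h s) * (e t * of_real (G (t - s))) :: complex"
  have int: "integrable lborel (\<lambda>t. ?f s t)" for s
    by (rule Bochner_Integration.integrable_bound[OF integrable_mult_right[OF shift(1)[of s], of "h s"]])
       (auto simp: norm_mult norm_e)
  have pair: "integrable (lborel \<Otimes>\<^sub>M lborel) (case_prod ?f)"
  proof (rule lborel_pair.Fubini_integrable)
    have "(LINT t|lborel. norm (?f s t)) = \<bar>h s\<bar> * (LINT t|lborel. \<bar>G t\<bar>)" for s
      by (simp add: norm_mult norm_e shift(2))
    thus "integrable lborel (\<lambda>s. LINT t|lborel. norm (case_prod ?f (s, t)))"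
      using h by simp
  qed (use int in auto)
  have "fourier (conv G h) \<xi> = (LINT t|lborel. LINT s|lborel. ?f s t)"
    unfolding fourier_def conv_def e_def[symmetric]
  proof (rule Bochner_Integration.integral_cong[OF refl])
    fix t
    have "e t * of_real (LINT s|lborel. G (t - s) * h s) = e t * (LINT s|lborel. of_real (G (t - s) * h s))"
      by (simp only: integral_complex_of_real)
    also have "\<dots> = (LINT s|lborel. e t * of_real (G (t - s) * h s))"
      by (rule integral_mult_right_zero[symmetric])
    also have "\<dots> = (LINT s|lborel. ?f s t)"
      by (rule Bochner_Integration.integral_cong) auto
    finally show "e t * of_real (LINT s|lborel. G (t - s) * h s) = (LINT s|lborel. ?f s t)" .
  qed
  also have "\<dots> = (LINT s|lborel. LINT t|lborel. ?f s t)"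
    by (rule lborel_pair.Fubini_integral[OF pair])
  also have "\<dots> = (LINT s|lborel. fourier G \<xi> * (e s * of_real (h s)))"
  proof (rule Bochner_Integration.integral_cong[OF refl])
    fix s
    have "(LINT t|lborel. ?f s t) = of_real (h s) * (LINT t|lborel. e t * of_real (G (t - s)))"
      by (rule integral_mult_right_zero)
    also have "(LINT t|lborel. e t * of_real (G (t - s))) = (LINT t|lborel. e (s + t) * of_real (G t))"
      using lborel_integral_real_affine[of 1 "\<lambda>t. e t * of_real (G (t - s))" s] by simp
    also have "\<dots> = (LINT t|lborel. e s * (e t * of_real (G t)))"
      by (rule Bochner_Integration.integral_cong[OF refl])
         (simp add: e_def algebra_simps mult_exp_exp)
    also have "\<dots> = e s * fourier G \<xi>"
      unfolding fourier_def e_def[symmetric] by (rule integral_mult_right_zero)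
    finally show "(LINT t|lborel. ?f s t) = fourier G \<xi> * (e s * of_real (h s))"
      by (simp add: mult_ac)
  qed
  also have "\<dots> = fourier G \<xi> * fourier h \<xi>"
    unfolding fourier_def[of h] e_def[symmetric] by (rule integral_mult_right_zero)
  finally show ?thesis .
qed

text \<open>Only \<open>h(t) = exp (-\<bar>t\<bar>)\<close> has to be tested, as its Fourier transform has no zeros.\<close>

lemma fourier_green_function:
  assumes "green_function \<Theta> \<kappa> G"
  shows "(\<Theta> (of_real \<xi>) - of_real \<kappa>) * fourier G \<xi> = 1"
proof -
  define h where "h t = exp (- \<bar>t\<bar>)" for t :: real
  have G: "integrable lborel G" using assms by (simp add: green_function_def)
  have h: "integrable lborel h"
    using has_bochner_integral_exp_abs[of 1] by (simp add: has_bochner_integral_iff h_def[abs_def])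
  have "fourier h \<xi> = 2 / (1 + of_real \<xi> ^ 2)"
    using has_bochner_integral_fourier_exp_abs[of 1 \<xi>]
    by (simp add: has_bochner_integral_iff h_def[abs_def] fourier_def)
  moreover have "1 + complex_of_real \<xi> ^ 2 \<noteq> 0"
  proof -
    have "1 + \<xi>\<^sup>2 \<noteq> 0" using zero_le_power2[of \<xi>] by linarith
    hence "complex_of_real (1 + \<xi>\<^sup>2) \<noteq> 0" by (simp only: of_real_eq_0_iff not_False_eq_True)
    thus ?thesis by simp
  qed
  ultimately have nz: "fourier h \<xi> \<noteq> 0" by simp
  have "exp_decay 1 1 h"
  proof -
    have "eventually (\<lambda>t. norm (h t) \<le> 1 * norm (exp (- 1 * t))) at_top"
      using eventually_ge_at_top[of 0] by eventually_elim (simp add: h_def)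
    moreover have "eventually (\<lambda>t. norm (h t) \<le> 1 * norm (exp (1 * t))) at_bot"
      using eventually_le_at_bot[of 0] by eventually_elim (simp add: h_def)
    ultimately show ?thesis unfolding exp_decay_def by (blast intro: bigoI)
  qed
  moreover have "continuous_on UNIV h" unfolding h_def by (intro continuous_intros)
  ultimately have "multiplier_image (\<lambda>\<xi>. \<Theta> (of_real \<xi>)) (conv G h) (\<lambda>t. \<kappa> * conv G h t + h t)"
    using assms unfolding green_function_def by (meson zero_less_one)
  hence w: "integrable lborel (conv G h)"
    and eq: "fourier (\<lambda>t. \<kappa> * conv G h t + h t) \<xi> = \<Theta> (of_real \<xi>) * fourier (conv G h) \<xi>"
    by (auto simp: multiplier_image_def)
  have ints: "integrable lborel (\<lambda>t. exp (- (\<i> * of_real (\<xi> * t))) * of_real (f t) :: complex)"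
    if "integrable lborel f" for f
    by (rule Bochner_Integration.integrable_bound[OF that])
       (use borel_measurable_integrable[OF that] in \<open>auto simp: norm_mult norm_exp_eq_Re\<close>)
  have "fourier (\<lambda>t. \<kappa> * conv G h t + h t) \<xi> = (LINT t|lborel.
      of_real \<kappa> * (exp (- (\<i> * of_real (\<xi> * t))) * of_real (conv G h t)) +
      exp (- (\<i> * of_real (\<xi> * t))) * of_real (h t))"
    unfolding fourier_def by (rule Bochner_Integration.integral_cong) (auto simp: algebra_simps)
  also have "\<dots> = of_real \<kappa> * fourier (conv G h) \<xi> + fourier h \<xi>"
    using ints[OF w] ints[OF h] by (simp add: fourier_def)
  finally have "\<Theta> (of_real \<xi>) * fourier (conv G h) \<xi> = of_real \<kappa> * fourier (conv G h) \<xi> + fourier h \<xi>"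
    using eq by simp
  hence "((\<Theta> (of_real \<xi>) - of_real \<kappa>) * fourier G \<xi>) * fourier h \<xi> = 1 * fourier h \<xi>"
    unfolding fourier_conv[OF G h] by (simp add: algebra_simps)
  thus ?thesis using nz by (simp only: mult_cancel_right) simp
qed

section \<open>Convolution with exponential kernels\<close>

text \<open>Splitting at the fixed point \<open>t - 1\<close> leaves an integral over a compact
  interval with variable end, to which the fundamental theorem applies; t is interior to
  \<open>{t - 1..t + 1}\<close>.\<close>

lemma has_real_derivative_lower_tail_integral:
  fixes f :: "real \<Rightarrow> real"
  assumes cont: "continuous_on UNIV f" and int: "\<And>x. f integrable_on {..x}"
  shows "((\<lambda>x. integral {..x} f) has_real_derivative f t) (at t)"
proof -
  have split: "integral {..x} f = integral {..t - 1} f + integral {t - 1..x} f" if "x \<in> {t - 1..t + 1}" for x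
  proof -
    have "integral ({..t - 1} \<union> {t - 1..x}) f = integral {..t - 1} f + integral {t - 1..x} f"
    proof (rule Henstock_Kurzweil_Integration.integral_Un[OF int])
      show "f integrable_on {t - 1..x}"
        by (rule integrable_continuous_real) (rule continuous_on_subset[OF cont], simp)
      have "{..t - 1} \<inter> {t - 1..x} = {t - 1}" using that by auto
      thus "negligible ({..t - 1} \<inter> {t - 1..x})" by simp
    qed
    moreover have "{..t - 1} \<union> {t - 1..x} = {..x}" using that by auto
    ultimately show ?thesis by simp
  qed
  have "((\<lambda>x. integral {t - 1..x} f) has_real_derivative f t) (at t within {t - 1..t + 1})"
    by (rule integral_has_real_derivative) (auto intro: continuous_on_subset[OF cont])
  hence "((\<lambda>x. integral {..t - 1} f + integral {t - 1..x} f) has_real_derivative 0 + f t) (at t within {t - 1..t + 1})"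
    by (intro derivative_intros)
  hence "((\<lambda>x. integral {..x} f) has_real_derivative 0 + f t) (at t within {t - 1..t + 1})"
    by (rule has_field_derivative_transform_within[where d = 1]) (auto intro: split[symmetric])
  moreover have "at t within {t - 1..t + 1} = at t"
    by (rule at_within_interior) simp
  ultimately show ?thesis by simp
qed

lemma has_real_derivative_upper_tail_integral:
  fixes f :: "real \<Rightarrow> real"
  assumes cont: "continuous_on UNIV f" and int: "\<And>x. f integrable_on {x..}"
  shows "((\<lambda>x. integral {x..} f) has_real_derivative - f t) (at t)"
proof -
  have split: "integral {x..} f = integral {t - 1..} f - integral {t - 1..x} f" if "x \<in> {t - 1..t + 1}" for x
  proof -
    have "integral ({t - 1..x} \<union> {x..}) f = integral {t - 1..x} f + integral {x..} f"
    proof (rule Henstock_Kurzweil_Integration.integral_Un[OF _ int])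
      show "f integrable_on {t - 1..x}"
        by (rule integrable_continuous_real) (rule continuous_on_subset[OF cont], simp)
      have "{t - 1..x} \<inter> {x..} = {x}" using that by auto
      thus "negligible ({t - 1..x} \<inter> {x..})" by simp
    qed
    moreover have "{t - 1..x} \<union> {x..} = {t - 1..}" using that by auto
    ultimately show ?thesis by simp
  qed
  have "((\<lambda>x. integral {t - 1..x} f) has_real_derivative f t) (at t within {t - 1..t + 1})"
    by (rule integral_has_real_derivative) (auto intro: continuous_on_subset[OF cont])
  hence "((\<lambda>x. integral {t - 1..} f - integral {t - 1..x} f) has_real_derivative 0 - f t) (at t within {t - 1..t + 1})"
    by (intro derivative_intros)
  hence "((\<lambda>x. integral {x..} f) has_real_derivative 0 - f t) (at t within {t - 1..t + 1})"
    by (rule has_field_derivative_transform_within[where d = 1]) (auto intro: split[symmetric])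
  moreover have "at t within {t - 1..t + 1} = at t"
    by (rule at_within_interior) simp
  ultimately show ?thesis by simp
qed

text \<open>Splitting at s = t gives w = exp (- \<sigma> t) P + exp (\<sigma> t) Q with tail
  integrals P and Q that no longer contain the kernel. The boundary terms h t cancel in the first
  derivative; in the second they add up to - 2 \<sigma> h t.\<close>

lemma exp_kernel_ode:
  fixes h w :: "real \<Rightarrow> real"
  assumes cont: "continuous_on UNIV h"
    and int: "\<And>t. integrable lborel (\<lambda>s. exp (- \<sigma> * \<bar>t - s\<bar>) * h s)"
    and w: "\<And>t. w t = (LINT s|lborel. exp (- \<sigma> * \<bar>t - s\<bar>) * h s)"
  shows "w differentiable (at t)" "deriv w differentiable (at t)"
    "deriv (deriv w) t - \<sigma>\<^sup>2 * w t = - 2 * \<sigma> * h t"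
proof -
  let ?k = "\<lambda>t s. exp (- \<sigma> * \<bar>t - s\<bar>) * h s"
  define f where "f s = exp (\<sigma> * s) * h s" for s
  define g where "g s = exp (- \<sigma> * s) * h s" for s
  define P where "P t = integral {..t} f" for t
  define Q where "Q t = integral {t..} g" for t
  have k_int: "?k t integrable_on S" if "S \<in> sets lborel" for t S
    using integrable_mult_indicator[OF that int[of t]]
    by (intro set_borel_integral_eq_integral(1)) (simp add: set_integrable_def)
  have fk: "exp (\<sigma> * t) * ?k t s = f s" if "s \<in> {..t}" for s t
    using that by (simp add: f_def mult_exp_exp algebra_simps flip: mult.assoc)
  have gk: "exp (- \<sigma> * t) * ?k t s = g s" if "s \<in> {t..}" for s t
    using that by (simp add: g_def mult_exp_exp algebra_simps flip: mult.assoc)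
  have kf: "?k t s = exp (- \<sigma> * t) * f s" if "s \<in> {..t}" for s t
    using that by (simp add: f_def mult_exp_exp algebra_simps flip: mult.assoc)
  have kg: "?k t s = exp (\<sigma> * t) * g s" if "s \<in> {t..}" for s t
    using that by (simp add: g_def mult_exp_exp algebra_simps flip: mult.assoc)
  have "(\<lambda>s. exp (\<sigma> * t) * ?k t s) integrable_on {..t}" for t
    by (intro integrable_on_mult_right k_int) simp
  hence f_int: "f integrable_on {..t}" for t
    by (rule integrable_eq) (rule fk)
  have "(\<lambda>s. exp (- \<sigma> * t) * ?k t s) integrable_on {t..}" for t
    by (intro integrable_on_mult_right k_int) simp
  hence g_int: "g integrable_on {t..}" for t
    by (rule integrable_eq) (rule gk)
  have w_eq: "w t = exp (- \<sigma> * t) * P t + exp (\<sigma> * t) * Q t" for t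
  proof -
    have "w t = integral UNIV (?k t)"
      unfolding w using int by (intro integral_lborel[symmetric])
    also have "(UNIV :: real set) = {..t} \<union> {t..}" by auto
    also have "integral ({..t} \<union> {t..}) (?k t) = integral {..t} (?k t) + integral {t..} (?k t)"
    proof (rule Henstock_Kurzweil_Integration.integral_Un)
      have "{..t} \<inter> {t..} = {t}" by auto
      thus "negligible ({..t} \<inter> {t..})" by simp
    qed (intro k_int; simp)+
    also have "integral {..t} (?k t) = integral {..t} (\<lambda>s. exp (- \<sigma> * t) * f s)"
      by (rule Henstock_Kurzweil_Integration.integral_cong) (rule kf)
    also have "integral {t..} (?k t) = integral {t..} (\<lambda>s. exp (\<sigma> * t) * g s)"
      by (rule Henstock_Kurzweil_Integration.integral_cong) (rule kg)
    finally show ?thesis by (simp add: P_def Q_def)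
  qed
  have dP: "(P has_real_derivative f t) (at t)" for t
    unfolding P_def using f_int cont
    by (intro has_real_derivative_lower_tail_integral) (auto simp: f_def intro!: continuous_intros)
  have dQ: "(Q has_real_derivative - g t) (at t)" for t
    unfolding Q_def using g_int cont
    by (intro has_real_derivative_upper_tail_integral) (auto simp: g_def intro!: continuous_intros)
  define w' where "w' t = \<sigma> * (exp (\<sigma> * t) * Q t - exp (- \<sigma> * t) * P t)" for t
  have ef: "exp (- \<sigma> * t) * f t = h t" and eg: "exp (\<sigma> * t) * g t = h t" for t
    by (simp_all add: f_def g_def mult_exp_exp flip: mult.assoc)
  have dw: "(w has_real_derivative w' t) (at t)" for t
    unfolding w_eq[abs_def] w'_def
    by (rule derivative_eq_intros dP dQ refl)+ (use ef[of t] eg[of t] in \<open>simp add: algebra_simps\<close>)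
  hence deriv_w: "deriv w = w'" by (intro ext DERIV_imp_deriv)
  have dw': "(w' has_real_derivative \<sigma>\<^sup>2 * w t - 2 * \<sigma> * h t) (at t)" for t
    unfolding w_eq w'_def[abs_def]
    by (rule derivative_eq_intros dP dQ refl)+
       (use ef[of t] eg[of t] in \<open>simp add: algebra_simps power2_eq_square\<close>)
  show "w differentiable (at t)" "deriv w differentiable (at t)"
    "deriv (deriv w) t - \<sigma>\<^sup>2 * w t = - 2 * \<sigma> * h t"
    using dw dw' DERIV_imp_deriv[OF dw'[of t]]
    by (auto simp: deriv_w real_differentiable_def)
qed

section \<open>Exponential bounds and termwise convolution\<close>

lemma exp_decay_imp_exp_bound:
  fixes h :: "real \<Rightarrow> real"
  assumes "exp_decay \<delta> \<delta>0 h" "\<delta> > - s" "\<delta>0 > - s" "s > 0" and cont: "continuous_on UNIV h"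
  shows "\<exists>\<eta> M. 0 \<le> \<eta> \<and> \<eta> < s \<and> 0 \<le> M \<and> (\<forall>t. \<bar>h t\<bar> \<le> M * exp (\<eta> * \<bar>t\<bar>))"
proof -
  \<comment> \<open>The rates \<delta> and \<delta>0 may be negative, so h may grow. Including 0 in
    the maximum makes exp (\<eta> |t|) \<ge> 1, which absorbs the bound of h on a compact
    interval.\<close>
  define \<eta> where "\<eta> = Max {0, - \<delta>, - \<delta>0}"
  have \<eta>: "0 \<le> \<eta>" "- \<delta> \<le> \<eta>" "- \<delta>0 \<le> \<eta>" "\<eta> < s" using assms by (simp_all add: \<eta>_def)
  have "h \<in> O[at_top](\<lambda>t. exp (- \<delta> * t))" "h \<in> O[at_bot](\<lambda>t. exp (\<delta>0 * t))"
    using assms(1) by (simp_all add: exp_decay_def)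
  from this(1) obtain C where C: "C > 0" "\<forall>\<^sub>F t in at_top. norm (h t) \<le> C * norm (exp (- \<delta> * t))"
    by (rule landau_o.bigE)
  from \<open>h \<in> O[at_bot](_)\<close> obtain C0 where C0: "C0 > 0"
      "\<forall>\<^sub>F t in at_bot. norm (h t) \<le> C0 * norm (exp (\<delta>0 * t))"
    by (rule landau_o.bigE)
  obtain a b where a: "\<And>t. t \<ge> a \<Longrightarrow> \<bar>h t\<bar> \<le> C * exp (- \<delta> * t)"
    and b: "\<And>t. t \<le> b \<Longrightarrow> \<bar>h t\<bar> \<le> C0 * exp (\<delta>0 * t)"
    using C(2) C0(2) by (auto simp: eventually_at_top_linorder eventually_at_bot_linorder)
  define r where "r = \<bar>a\<bar> + \<bar>b\<bar>"
  have "compact (h ` {- r..r})"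
    by (intro compact_continuous_image compact_Icc continuous_on_subset[OF cont]) simp
  hence "bounded (h ` {- r..r})" by (rule compact_imp_bounded)
  then obtain D where "\<forall>y\<in>h ` {- r..r}. norm y \<le> D" unfolding bounded_iff by blast
  hence D: "\<bar>h t\<bar> \<le> D" if "t \<in> {- r..r}" for t using that by auto
  show ?thesis
  proof (rule exI[of _ \<eta>], rule exI[of _ "C + C0 + \<bar>D\<bar>"], intro conjI allI)
    fix t :: real
    have ge1: "exp (\<eta> * \<bar>t\<bar>) \<ge> 1" using \<eta> by simp
    show "\<bar>h t\<bar> \<le> (C + C0 + \<bar>D\<bar>) * exp (\<eta> * \<bar>t\<bar>)"
    proof -
      consider "t \<in> {- r..r}" | "t > r" | "t < - r" by force
      hence "\<bar>h t\<bar> \<le> C * exp (\<eta> * \<bar>t\<bar>) \<or> \<bar>h t\<bar> \<le> C0 * exp (\<eta> * \<bar>t\<bar>) \<or> \<bar>h t\<bar> \<le> \<bar>D\<bar> * exp (\<eta> * \<bar>t\<bar>)"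
      proof cases
        case 1
        hence "\<bar>h t\<bar> \<le> \<bar>D\<bar> * 1" using D[of t] by simp
        also have "\<dots> \<le> \<bar>D\<bar> * exp (\<eta> * \<bar>t\<bar>)" using ge1 by (intro mult_left_mono) auto
        finally show ?thesis by simp
      next
        case 2
        hence "t \<ge> a" "t > 0" by (auto simp: r_def)
        have "- \<delta> * t \<le> \<eta> * \<bar>t\<bar>" using \<open>t > 0\<close> \<eta> mult_right_mono[of "- \<delta>" \<eta> t] by simp
        hence "C * exp (- \<delta> * t) \<le> C * exp (\<eta> * \<bar>t\<bar>)" using C by (intro mult_left_mono) auto
        thus ?thesis using a[OF \<open>t \<ge> a\<close>] by linarith
      next
        case 3
        hence "t \<le> b" "t < 0" by (auto simp: r_def)
        have "\<delta>0 * t \<le> \<eta> * \<bar>t\<bar>" using \<open>t < 0\<close> \<eta> mult_right_mono[of "- \<delta>0" \<eta> "- t"] by simp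
        hence "C0 * exp (\<delta>0 * t) \<le> C0 * exp (\<eta> * \<bar>t\<bar>)" using C0 by (intro mult_left_mono) auto
        thus ?thesis using b[OF \<open>t \<le> b\<close>] by linarith
      qed
      moreover have "C * exp (\<eta> * \<bar>t\<bar>) \<ge> 0" "C0 * exp (\<eta> * \<bar>t\<bar>) \<ge> 0" "\<bar>D\<bar> * exp (\<eta> * \<bar>t\<bar>) \<ge> 0"
        using C C0 by auto
      ultimately show ?thesis unfolding distrib_right by linarith
    qed
  qed (use \<eta> C C0 in auto)
qed

text \<open>By |s| \<le> |t| + |t - s| the growth of h splits into the constant factor exp (\<eta>
  |t|) and a loss of \<eta> in the decay rate of the kernel; what remains has integral
  \<open>2 / (\<sigma> - \<eta>)\<close>.\<close>

lemma exp_kernel_bound: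
  fixes h :: "real \<Rightarrow> real"
  assumes [measurable]: "h \<in> borel_measurable borel" and bound: "\<And>s. \<bar>h s\<bar> \<le> M * exp (\<eta> * \<bar>s\<bar>)"
    and "0 \<le> \<eta>" "\<eta> < \<sigma>" "0 \<le> M"
  shows "integrable lborel (\<lambda>s. exp (- \<sigma> * \<bar>t - s\<bar>) * h s)"
    and "(LINT s|lborel. \<bar>exp (- \<sigma> * \<bar>t - s\<bar>) * h s\<bar>) \<le> M * exp (\<eta> * \<bar>t\<bar>) * (2 / (\<sigma> - \<eta>))"
proof -
  have "has_bochner_integral lborel (\<lambda>s. exp (- (\<sigma> - \<eta>) * \<bar>s\<bar>)) (2 / (\<sigma> - \<eta>))"
    using assms by (intro has_bochner_integral_exp_abs) simp
  hence "has_bochner_integral lborel (\<lambda>s. exp (- (\<sigma> - \<eta>) * \<bar>t + (- 1) * s\<bar>)) (2 / (\<sigma> - \<eta>))"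
    by (subst (asm) lborel_has_bochner_integral_real_affine_iff[of "- 1" _ _ t]) simp_all
  hence B: "has_bochner_integral lborel (\<lambda>s. M * exp (\<eta> * \<bar>t\<bar>) * exp (- (\<sigma> - \<eta>) * \<bar>t - s\<bar>))
      (M * exp (\<eta> * \<bar>t\<bar>) * (2 / (\<sigma> - \<eta>)))"
    by (intro has_bochner_integral_mult_right) simp
  have le: "\<bar>exp (- \<sigma> * \<bar>t - s\<bar>) * h s\<bar> \<le> M * exp (\<eta> * \<bar>t\<bar>) * exp (- (\<sigma> - \<eta>) * \<bar>t - s\<bar>)" for s
  proof -
    have "\<eta> * \<bar>s\<bar> \<le> \<eta> * (\<bar>t\<bar> + \<bar>t - s\<bar>)" using \<open>0 \<le> \<eta>\<close> by (intro mult_left_mono) auto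
    hence "M * exp (\<eta> * \<bar>s\<bar>) \<le> M * exp (\<eta> * (\<bar>t\<bar> + \<bar>t - s\<bar>))"
      using \<open>0 \<le> M\<close> by (intro mult_left_mono) auto
    hence "\<bar>h s\<bar> \<le> M * exp (\<eta> * (\<bar>t\<bar> + \<bar>t - s\<bar>))" using bound[of s] by linarith
    hence "exp (- \<sigma> * \<bar>t - s\<bar>) * \<bar>h s\<bar> \<le> exp (- \<sigma> * \<bar>t - s\<bar>) * (M * exp (\<eta> * (\<bar>t\<bar> + \<bar>t - s\<bar>)))"
      by (intro mult_left_mono) auto
    also have "\<dots> = M * exp (- \<sigma> * \<bar>t - s\<bar> + \<eta> * (\<bar>t\<bar> + \<bar>t - s\<bar>))"
      unfolding exp_add by (simp only: mult_ac)
    also have "- \<sigma> * \<bar>t - s\<bar> + \<eta> * (\<bar>t\<bar> + \<bar>t - s\<bar>) = \<eta> * \<bar>t\<bar> + - (\<sigma> - \<eta>) * \<bar>t - s\<bar>"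
      by (simp add: algebra_simps)
    finally show ?thesis by (simp add: abs_mult exp_add)
  qed
  have int_B: "integrable lborel (\<lambda>s. M * exp (\<eta> * \<bar>t\<bar>) * exp (- (\<sigma> - \<eta>) * \<bar>t - s\<bar>))"
    using B by (simp add: has_bochner_integral_iff)
  show int: "integrable lborel (\<lambda>s. exp (- \<sigma> * \<bar>t - s\<bar>) * h s)"
    by (rule Bochner_Integration.integrable_bound[OF int_B])
       (use le in \<open>auto intro: order_trans[OF _ abs_ge_self]\<close>)
  have "(LINT s|lborel. \<bar>exp (- \<sigma> * \<bar>t - s\<bar>) * h s\<bar>)
      \<le> (LINT s|lborel. M * exp (\<eta> * \<bar>t\<bar>) * exp (- (\<sigma> - \<eta>) * \<bar>t - s\<bar>))"
    by (intro integral_mono integrable_abs int int_B le)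
  thus "(LINT s|lborel. \<bar>exp (- \<sigma> * \<bar>t - s\<bar>) * h s\<bar>) \<le> M * exp (\<eta> * \<bar>t\<bar>) * (2 / (\<sigma> - \<eta>))"
    using B by (simp add: has_bochner_integral_iff)
qed

text \<open>The weight \<open>2 / \<sigma> j\<close> is the integral of the j-th exponential. As the
  terms are nonnegative, each partial sum is below G off 0, and integration bounds \<Sum> c j (2 /
  \<sigma> j) even where \<Sum> c j diverges.\<close>

lemma conv_nonneg_exp_series:
  fixes c \<sigma> :: "nat \<Rightarrow> real" and G h :: "real \<Rightarrow> real"
  assumes c: "\<And>j. c j \<ge> 0" and \<sigma>: "\<And>j. \<sigma>0 \<le> \<sigma> j" "0 < \<sigma>0"
    and G: "integrable lborel G"
    and series: "\<And>t. t \<noteq> 0 \<Longrightarrow> (\<lambda>j. c j * exp (- \<sigma> j * \<bar>t\<bar>)) sums G t"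
    and h[measurable]: "h \<in> borel_measurable borel"
    and bound: "\<And>s. \<bar>h s\<bar> \<le> M * exp (\<eta> * \<bar>s\<bar>)" "0 \<le> \<eta>" "\<eta> < \<sigma>0" "0 \<le> M"
  shows "integrable lborel (\<lambda>s. G (t - s) * h s)"
    and "(\<lambda>j. c j * conv (\<lambda>s. exp (- \<sigma> j * \<bar>s\<bar>)) h t) sums conv G h t"
proof -
  have [measurable]: "G \<in> borel_measurable borel" using G by (auto dest: borel_measurable_integrable)
  have \<sigma>_pos: "\<sigma> j > 0" "\<eta> < \<sigma> j" for j using \<sigma>(1)[of j] \<sigma>(2) bound by auto
  have E: "has_bochner_integral lborel (\<lambda>t. c j * exp (- \<sigma> j * \<bar>t\<bar>)) (c j * (2 / \<sigma> j))" for j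
    by (intro has_bochner_integral_mult_right has_bochner_integral_exp_abs \<sigma>_pos)
  have AE0: "AE t in lborel. t \<noteq> (0::real)" by (rule AE_lborel_singleton)
  have "summable (\<lambda>j. c j * (2 / \<sigma> j))"
  proof (rule summableI_nonneg_bounded)
    fix N
    have "(\<Sum>j<N. c j * (2 / \<sigma> j)) = (LINT t|lborel. (\<Sum>j<N. c j * exp (- \<sigma> j * \<bar>t\<bar>)))"
      using has_bochner_integral_sum[of "{..<N}", OF E] by (simp add: has_bochner_integral_iff)
    also have "\<dots> \<le> (LINT t|lborel. G t)"
    proof (rule integral_mono_AE[OF _ G])
      show "integrable lborel (\<lambda>t. \<Sum>j<N. c j * exp (- \<sigma> j * \<bar>t\<bar>))"
        using has_bochner_integral_sum[of "{..<N}", OF E] by (simp add: has_bochner_integral_iff)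
      show "AE t in lborel. (\<Sum>j<N. c j * exp (- \<sigma> j * \<bar>t\<bar>)) \<le> G t"
        using AE0
      proof eventually_elim
        case (elim t)
        show ?case
          using sum_le_suminf[of "\<lambda>j. c j * exp (- \<sigma> j * \<bar>t\<bar>)" "{..<N}"] series[OF elim] c
          by (simp add: sums_iff)
      qed
    qed
    finally show "(\<Sum>j<N. c j * (2 / \<sigma> j)) \<le> (LINT t|lborel. G t)" .
  qed (use c \<sigma>_pos in \<open>simp add: less_imp_le\<close>)
  define K where "K = M * exp (\<eta> * \<bar>t\<bar>) * (\<sigma>0 / (\<sigma>0 - \<eta>))"
  let ?f = "\<lambda>j s. c j * (exp (- \<sigma> j * \<bar>t - s\<bar>) * h s)"
  note kernel = exp_kernel_bound[OF h bound(1,2) \<sigma>_pos(2) bound(4), where t = t]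
  have int_f: "integrable lborel (?f j)" for j
    by (intro integrable_mult_right kernel)
  have summable_norm: "summable (\<lambda>j. LINT s|lborel. norm (?f j s))"
  proof (rule summable_comparison_test'[where N = 0])
    show "summable (\<lambda>j. K * (c j * (2 / \<sigma> j)))"
      by (rule summable_mult) fact
    fix j
    \<comment> \<open>Since \<sigma> j \<ge> \<sigma>0, the loss of \<eta> in the rate costs at most
      the factor \<open>\<sigma>0 / (\<sigma>0 - \<eta>)\<close>, uniformly in j.\<close>
    have "2 / (\<sigma> j - \<eta>) \<le> \<sigma>0 / (\<sigma>0 - \<eta>) * (2 / \<sigma> j)"
    proof -
      have "\<sigma>0 * \<eta> \<le> \<sigma> j * \<eta>" using \<sigma>(1) bound(2) by (rule mult_right_mono)
      thus ?thesis using \<sigma>_pos[of j] \<sigma> bound by (simp add: field_simps)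
    qed
    hence "M * exp (\<eta> * \<bar>t\<bar>) * (2 / (\<sigma> j - \<eta>)) \<le> K * (2 / \<sigma> j)"
      unfolding K_def mult.assoc using bound(4) by (intro mult_left_mono) auto
    hence le: "(LINT s|lborel. \<bar>exp (- \<sigma> j * \<bar>t - s\<bar>) * h s\<bar>) \<le> K * (2 / \<sigma> j)"
      using kernel(2)[of j] by linarith
    have "(LINT s|lborel. norm (?f j s)) = c j * (LINT s|lborel. \<bar>exp (- \<sigma> j * \<bar>t - s\<bar>) * h s\<bar>)"
      using c[of j] by (simp add: abs_mult)
    also have "\<dots> \<le> c j * (K * (2 / \<sigma> j))" using le c by (rule mult_left_mono)
    finally show "norm (LINT s|lborel. norm (?f j s)) \<le> K * (c j * (2 / \<sigma> j))"
      by (simp add: mult_ac)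
  qed
  have sums_f: "(\<lambda>j. ?f j s) sums (G (t - s) * h s)" if "s \<noteq> t" for s
    using sums_mult2[OF series[of "t - s"], of "h s"] that by (simp add: mult.assoc)
  have AEt: "AE s in lborel. s \<noteq> t" by (rule AE_lborel_singleton)
  have AE_norm: "AE s in lborel. summable (\<lambda>j. norm (?f j s))"
    using AEt
  proof eventually_elim
    case (elim s)
    have "summable (\<lambda>j. c j * exp (- \<sigma> j * \<bar>t - s\<bar>) * \<bar>h s\<bar>)"
      using series[of "t - s"] elim by (intro summable_mult2) (auto simp: sums_iff)
    thus ?case using c by (simp add: abs_mult mult.assoc)
  qed
  have AE_eq: "AE s in lborel. (\<Sum>j. ?f j s) = G (t - s) * h s"
    using AEt by eventually_elim (use sums_f in \<open>simp add: sums_iff\<close>)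
  have "integrable lborel (\<lambda>s. \<Sum>j. ?f j s)"
    by (rule integrable_suminf[OF int_f AE_norm summable_norm])
  thus "integrable lborel (\<lambda>s. G (t - s) * h s)"
    using AE_eq by (subst (asm) integrable_cong_AE) auto
  have "(\<lambda>j. integral\<^sup>L lborel (?f j)) sums (LINT s|lborel. (\<Sum>j. ?f j s))"
    by (rule sums_integral[OF int_f AE_norm summable_norm])
  also have "(LINT s|lborel. (\<Sum>j. ?f j s)) = conv G h t"
    unfolding conv_def using AE_eq by (intro integral_cong_AE) auto
  finally show "(\<lambda>j. c j * conv (\<lambda>s. exp (- \<sigma> j * \<bar>s\<bar>)) h t) sums conv G h t"
    by (simp add: conv_def)
qed

section \<open>Poles of the resolvent on the imaginary axis\<close>

text \<open>Off the zeros of D the function equals D / (N - \<kappa> D), which has a finite limit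
  unless N = \<kappa> D at the point. Values produced by division by zero have to be treated
  separately, since the pole is stated for the total HOL function.\<close>

lemma is_pole_quotient_minus_const:
  fixes N D :: "complex \<Rightarrow> complex"
  assumes contN: "isCont N z0" and contD: "isCont D z0" and "N z0 \<noteq> 0 \<or> D z0 \<noteq> 0"
    and pole: "is_pole (\<lambda>z. 1 / (N z / D z - \<kappa>)) z0"
  shows "D z0 \<noteq> 0" "N z0 = \<kappa> * D z0" "\<forall>\<^sub>F z in at z0. N z \<noteq> \<kappa> * D z"
proof -
  let ?f = "\<lambda>z. 1 / (N z / D z - \<kappa>)" and ?g = "\<lambda>z. D z / (N z - \<kappa> * D z)"
  have fg: "?f z = ?g z" if "D z \<noteq> 0" for z
  proof -
    have "N z / D z - \<kappa> = (N z - \<kappa> * D z) / D z" using that by (simp add: field_simps)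
    thus ?thesis by simp
  qed
  have inf: "filterlim ?f at_infinity (at z0)" using pole by (simp add: is_pole_def)
  hence large: "\<forall>\<^sub>F z in at z0. r \<le> norm (?f z)" if "r > 0" for r
    using that filterlim_at_infinity[of 0 ?f "at z0"] by auto
  have limN: "(N \<longlongrightarrow> N z0) (at z0)" and limD: "(D \<longlongrightarrow> D z0) (at z0)"
    using contN contD by (simp_all add: isCont_def)
  show D: "D z0 \<noteq> 0"
  proof
    assume "D z0 = 0"
    \<comment> \<open>Where D vanishes the function has the fixed value
      \<open>1 / (0 - \<kappa>)\<close>; elsewhere near \<open>z0\<close> its norm is below 1. The
      number \<open>r\<close> exceeds both, contradicting the pole.\<close>
    define r where "r = 1 + norm (1 / (0 - \<kappa>))"
    have "(?g \<longlongrightarrow> D z0 / (N z0 - \<kappa> * D z0)) (at z0)"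
      using assms(3) \<open>D z0 = 0\<close> by (intro tendsto_intros limN limD) auto
    hence "\<forall>\<^sub>F z in at z0. norm (?g z) < 1"
      using \<open>D z0 = 0\<close> by (intro order_tendstoD(2)[of _ "0::real"] tendsto_norm_zero) simp_all
    moreover have "\<forall>\<^sub>F z in at z0. r \<le> norm (?f z)"
      by (rule large) (use norm_ge_zero[of "1 / (0 - \<kappa>)"] in \<open>unfold r_def, linarith\<close>)
    ultimately have "\<forall>\<^sub>F z in at z0. False"
    proof eventually_elim
      case (elim z)
      show ?case
      proof (cases "D z = 0")
        case True
        thus ?thesis using elim(2) by (simp add: r_def)
      next
        case False
        have "r < 1" using elim fg[OF False] by simp
        thus ?thesis using norm_ge_zero[of "1 / (0 - \<kappa>)"] unfolding r_def by linarith
      qed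
    qed
    thus False by simp
  qed
  have D_near: "\<forall>\<^sub>F z in at z0. D z \<noteq> 0" using tendsto_imp_eventually_ne[OF limD D] .
  show "N z0 = \<kappa> * D z0"
  proof (rule ccontr)
    assume "N z0 \<noteq> \<kappa> * D z0"
    hence "(?g \<longlongrightarrow> D z0 / (N z0 - \<kappa> * D z0)) (at z0)"
      by (intro tendsto_intros limN limD) simp
    moreover have "\<forall>\<^sub>F z in at z0. ?f z = ?g z"
      using D_near by eventually_elim (rule fg)
    ultimately have "(?f \<longlongrightarrow> D z0 / (N z0 - \<kappa> * D z0)) (at z0)"
      using tendsto_cong by fastforce
    thus False using not_tendsto_and_filterlim_at_infinity[OF _ _ inf] by simp
  qed
  \<comment> \<open>At a point with N = \<kappa> D and D \<noteq> 0 the function would be 1 / 0 = 0,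
    yet its norm is at least 1 near the pole.\<close>
  show "\<forall>\<^sub>F z in at z0. N z \<noteq> \<kappa> * D z"
    using D_near large[OF zero_less_one] by eventually_elim auto
qed

section \<open>The symbol as a quotient of entire functions\<close>

definition Theta_num :: "nat \<Rightarrow> real \<Rightarrow> real \<Rightarrow> complex \<Rightarrow> complex" where
  "Theta_num n \<gamma> \<nu> z = of_real (2 powr (2*\<gamma>)) *
     (rGamma (of_real (B_coef n \<gamma> \<nu>) + z * \<i> / 2) * rGamma (of_real (B_coef n \<gamma> \<nu>) - z * \<i> / 2))"

definition Theta_den :: "nat \<Rightarrow> real \<Rightarrow> real \<Rightarrow> complex \<Rightarrow> complex" where
  "Theta_den n \<gamma> \<nu> z =
     rGamma (of_real (A_coef n \<gamma> \<nu>) + z * \<i> / 2) * rGamma (of_real (A_coef n \<gamma> \<nu>) - z * \<i> / 2)"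

text \<open>Valid at every z, poles included: \<open>Gamma\<close> is the inverse of
  \<open>rGamma\<close>, and the default value 0 arises on both sides alike.\<close>

lemma Theta_eq_quotient: "Theta n \<gamma> \<nu> z = Theta_num n \<gamma> \<nu> z / Theta_den n \<gamma> \<nu> z"
  by (simp add: Theta_def Theta_num_def Theta_den_def Gamma_def field_simps)

lemma holomorphic_Theta_num: "Theta_num n \<gamma> \<nu> holomorphic_on S"
  and holomorphic_Theta_den: "Theta_den n \<gamma> \<nu> holomorphic_on S"
  unfolding Theta_num_def Theta_den_def by (intro holomorphic_intros; simp)+

lemma isCont_Theta_num: "isCont (Theta_num n \<gamma> \<nu>) z"
  and isCont_Theta_den: "isCont (Theta_den n \<gamma> \<nu>) z"
  using holomorphic_Theta_num[of n \<gamma> \<nu> UNIV] holomorphic_Theta_den[of n \<gamma> \<nu> UNIV]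
  by (auto dest!: holomorphic_on_imp_continuous_on simp: continuous_on_eq_continuous_at)

lemma Theta_num_imag_axis:
  "Theta_num n \<gamma> \<nu> (Complex 0 s) = of_real (2 powr (2*\<gamma>) *
     (rGamma (B_coef n \<gamma> \<nu> - s / 2) * rGamma (B_coef n \<gamma> \<nu> + s / 2)))"
proof -
  have "of_real b + Complex 0 s * \<i> / 2 = of_real (b - s / 2)"
    "of_real b - Complex 0 s * \<i> / 2 = of_real (b + s / 2)" for b
    by (simp_all add: complex_eq_iff)
  thus ?thesis unfolding Theta_num_def by (simp only: rGamma_complex_of_real of_real_mult)
qed

lemma Theta_den_imag_axis:
  "Theta_den n \<gamma> \<nu> (Complex 0 s) = of_real
     (rGamma (A_coef n \<gamma> \<nu> - s / 2) * rGamma (A_coef n \<gamma> \<nu> + s / 2))"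
proof -
  have "of_real b + Complex 0 s * \<i> / 2 = of_real (b - s / 2)"
    "of_real b - Complex 0 s * \<i> / 2 = of_real (b + s / 2)" for b
    by (simp_all add: complex_eq_iff)
  thus ?thesis unfolding Theta_den_def by (simp only: rGamma_complex_of_real of_real_mult)
qed

lemma Theta_imag_axis:
  "Theta n \<gamma> \<nu> (Complex 0 s) =
     of_real (2 powr (2*\<gamma>) * Gamma_quot (A_coef n \<gamma> \<nu>) (B_coef n \<gamma> \<nu>) (s / 2))"
  unfolding Theta_eq_quotient Theta_num_imag_axis Theta_den_imag_axis Gamma_quot_def by simp

lemma A_coef_B_coef:
  assumes "0 < \<gamma>" "\<gamma> < 1" "0 \<le> \<nu>"
  shows "0 < B_coef n \<gamma> \<nu>" "A_coef n \<gamma> \<nu> = B_coef n \<gamma> \<nu> + \<gamma>"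
  using assms by (simp_all add: A_coef_def B_coef_def add_pos_nonneg)

text \<open>On the real line both arguments have real part A > 0. This allows the Fourier identity
  for the Green function to be multiplied by the denominator.\<close>

lemma Theta_den_real_nonzero:
  assumes "0 < \<gamma>" "\<gamma> < 1" "0 \<le> \<nu>"
  shows "Theta_den n \<gamma> \<nu> (of_real \<xi>) \<noteq> 0"
proof -
  have "A_coef n \<gamma> \<nu> > 0" using A_coef_B_coef[OF assms, of n] assms by simp
  hence "of_real (A_coef n \<gamma> \<nu>) + of_real \<xi> * \<i> / 2 \<notin> \<int>\<^sub>\<le>\<^sub>0"
    "of_real (A_coef n \<gamma> \<nu>) - of_real \<xi> * \<i> / 2 \<notin> \<int>\<^sub>\<le>\<^sub>0"
    by (auto elim!: nonpos_Ints_cases' simp: complex_eq_iff)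
  thus ?thesis unfolding Theta_den_def by (simp add: rGamma_eq_zero_iff)
qed

text \<open>For s > 0 only the arguments B - s/2 and A - s/2 can be nonpositive integers. If both
  were, their difference \<gamma> would be an integer strictly between 0 and 1.\<close>

lemma Theta_num_den_no_common_zero:
  assumes "0 < \<gamma>" "\<gamma> < 1" "0 \<le> \<nu>" "0 < s"
  shows "Theta_num n \<gamma> \<nu> (Complex 0 s) \<noteq> 0 \<or> Theta_den n \<gamma> \<nu> (Complex 0 s) \<noteq> 0"
proof (rule ccontr)
  note AB = A_coef_B_coef[OF assms(1-3), of n]
  assume "\<not> ?thesis"
  hence "rGamma (B_coef n \<gamma> \<nu> - s / 2) * rGamma (B_coef n \<gamma> \<nu> + s / 2) = 0"
    and "rGamma (A_coef n \<gamma> \<nu> - s / 2) * rGamma (A_coef n \<gamma> \<nu> + s / 2) = 0"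
    unfolding Theta_num_imag_axis Theta_den_imag_axis by (simp_all del: of_real_mult)
  moreover have "B_coef n \<gamma> \<nu> + s / 2 \<noteq> - real k" "A_coef n \<gamma> \<nu> + s / 2 \<noteq> - real k" for k
    using AB assms of_nat_0_le_iff[of k, where ?'a = real] by linarith+
  ultimately obtain k l where "B_coef n \<gamma> \<nu> - s / 2 = - real k" "A_coef n \<gamma> \<nu> - s / 2 = - real l"
    by (auto simp: rGamma_real_eq_0_iff)
  hence "real k - real l = \<gamma>" using AB(2) by linarith
  hence "of_int (int k - int l) = \<gamma>" by simp
  hence "0 < int k - int l" "int k - int l < 1" using assms(1,2)
    by (simp_all only: of_int_0_less_iff[where ?'a = real, symmetric] of_int_less_1_iff[where ?'a = real, symmetric])
  thus False by linarith
qed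

section \<open>Poles on the positive imaginary axis\<close>

locale axial_poles =
  fixes n :: nat and \<gamma> \<nu> \<kappa> :: real and \<sigma> :: "nat \<Rightarrow> real"
  assumes \<gamma>: "0 < \<gamma>" "\<gamma> < 1" and \<nu>: "0 \<le> \<nu>"
    and \<sigma>_pos: "\<And>j. \<sigma> j > 0" and inj_\<sigma>: "inj \<sigma>"
    and pole: "\<And>j. is_pole (\<lambda>z. 1 / (Theta n \<gamma> \<nu> z - of_real \<kappa>)) (Complex 0 (\<sigma> j))"
begin

abbreviation "A \<equiv> A_coef n \<gamma> \<nu>"
abbreviation "B \<equiv> B_coef n \<gamma> \<nu>"
abbreviation "N \<equiv> Theta_num n \<gamma> \<nu>"
abbreviation "D \<equiv> Theta_den n \<gamma> \<nu>"
abbreviation "\<theta> s \<equiv> 2 powr (2*\<gamma>) * Gamma_quot A B (s / 2)"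

lemma pole_facts:
  shows "D (Complex 0 (\<sigma> j)) \<noteq> 0" "\<theta> (\<sigma> j) = \<kappa>" "\<forall>\<^sub>F z in at (Complex 0 (\<sigma> j)). N z \<noteq> of_real \<kappa> * D z"
proof -
  note * = is_pole_quotient_minus_const[OF isCont_Theta_num isCont_Theta_den
      Theta_num_den_no_common_zero[OF \<gamma> \<nu> \<sigma>_pos] pole[unfolded Theta_eq_quotient]]
  show D: "D (Complex 0 (\<sigma> j)) \<noteq> 0" by (rule *(1))
  show "\<forall>\<^sub>F z in at (Complex 0 (\<sigma> j)). N z \<noteq> of_real \<kappa> * D z" by (rule *(3))
  have "Theta n \<gamma> \<nu> (Complex 0 (\<sigma> j)) = of_real \<kappa>"
    using *(2)[of j] D by (simp add: Theta_eq_quotient)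
  thus "\<theta> (\<sigma> j) = \<kappa>" unfolding Theta_imag_axis by (simp only: of_real_eq_iff)
qed

lemma D_zero: "D (Complex 0 (2 * (A + real k))) = 0"
proof -
  have "rGamma (A - 2 * (A + real k) / 2) = 0"
    unfolding rGamma_real_eq_0_iff by (intro exI[of _ k]) (simp add: field_simps)
  thus ?thesis unfolding Theta_den_imag_axis by (simp only: mult_zero_left of_real_0)
qed

text \<open>The points 2 (A + k) are zeros of D, so nonvanishing of D on the interval keeps them out
  of it.\<close>

lemma \<theta>_antimono:
  assumes "0 \<le> s" "s \<le> t" "\<And>u. s \<le> u \<Longrightarrow> u \<le> t \<Longrightarrow> D (Complex 0 u) \<noteq> 0"
  shows "\<theta> t \<le> \<theta> s"
proof (rule mult_left_mono)
  show "Gamma_quot A B (t / 2) \<le> Gamma_quot A B (s / 2)"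
  proof (rule Gamma_quot_antimono)
    show "A + real k < s / 2 \<or> t / 2 < A + real k" for k
      using assms(3)[of "2 * (A + real k)"] D_zero[of k] by force
  qed (use A_coef_B_coef[OF \<gamma> \<nu>, of n] \<gamma> assms in auto)
qed simp

text \<open>Carries statements valid in a punctured neighbourhood of i s over to the points i u with
  u slightly above s.\<close>

lemma filterlim_imag_axis: "filterlim (Complex 0) (at (Complex 0 s)) (at_right s)"
proof (rule filterlim_atI)
  show "(Complex 0 \<longlongrightarrow> Complex 0 s) (at_right s)"
    by (intro tendsto_Complex tendsto_const tendsto_ident_at)
  show "\<forall>\<^sub>F x in at_right s. Complex 0 x \<noteq> Complex 0 s"
    using eventually_neq_at_within[of s s "{s<..}"] by eventually_elim simp
qed

lemma D_nonzero_right: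
  obtains d where "d > 0" "\<And>u. \<sigma> j \<le> u \<Longrightarrow> u \<le> \<sigma> j + d \<Longrightarrow> D (Complex 0 u) \<noteq> 0"
proof -
  have "(D \<longlongrightarrow> D (Complex 0 (\<sigma> j))) (at (Complex 0 (\<sigma> j)))"
    using isCont_Theta_den by (simp add: isCont_def)
  hence "\<forall>\<^sub>F z in at (Complex 0 (\<sigma> j)). D z \<noteq> 0"
    using pole_facts(1) by (rule tendsto_imp_eventually_ne)
  hence "\<forall>\<^sub>F u in at_right (\<sigma> j). D (Complex 0 u) \<noteq> 0"
    using filterlim_imag_axis by (rule eventually_compose_filterlim)
  then obtain b where b: "b > \<sigma> j" "\<And>u. \<sigma> j < u \<Longrightarrow> u < b \<Longrightarrow> D (Complex 0 u) \<noteq> 0"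
    by (auto simp: eventually_at_right_field)
  show thesis
  proof (rule that[of "(b - \<sigma> j) / 2"])
    fix u assume "\<sigma> j \<le> u" "u \<le> \<sigma> j + (b - \<sigma> j) / 2"
    moreover from this have "u < b" using b(1) by (simp add: field_simps)
    ultimately have "u = \<sigma> j \<or> \<sigma> j < u \<and> u < b" by auto
    thus "D (Complex 0 u) \<noteq> 0" using b(2) pole_facts(1) by auto
  qed (use b in auto)
qed

text \<open>Monotonicity gives \<theta> u \<le> \<theta> (\<sigma> j) = \<kappa>. Equality is
  excluded because N \<noteq> \<kappa> D close to the pole.\<close>

lemma \<theta>_right:
  "\<forall>\<^sub>F u in at_right (\<sigma> j). D (Complex 0 u) \<noteq> 0 \<and> \<theta> u < \<kappa>"
proof -
  obtain d where d: "d > 0" "\<And>u. \<sigma> j \<le> u \<Longrightarrow> u \<le> \<sigma> j + d \<Longrightarrow> D (Complex 0 u) \<noteq> 0"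
    using D_nonzero_right by blast
  have "\<forall>\<^sub>F u in at_right (\<sigma> j). N (Complex 0 u) \<noteq> of_real \<kappa> * D (Complex 0 u)"
    using pole_facts(3) filterlim_imag_axis by (rule eventually_compose_filterlim)
  moreover have "\<forall>\<^sub>F u in at_right (\<sigma> j). u < \<sigma> j + d"
    by (rule order_tendstoD(2)[OF tendsto_ident_at]) (use d in simp)
  moreover have "\<forall>\<^sub>F u in at_right (\<sigma> j). \<sigma> j < u"
    by (rule eventually_at_right_less)
  ultimately show ?thesis
  proof eventually_elim
    case (elim u)
    have D: "D (Complex 0 u) \<noteq> 0" using d(2)[of u] elim by simp
    have "Theta n \<gamma> \<nu> (Complex 0 u) \<noteq> of_real \<kappa>"
      using elim(1) D by (simp add: Theta_eq_quotient field_simps)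
    hence "\<theta> u \<noteq> \<kappa>" unfolding Theta_imag_axis by (simp only: of_real_eq_iff not_False_eq_True)
    moreover have "\<theta> u \<le> \<theta> (\<sigma> j)"
      by (rule \<theta>_antimono) (use elim d(2) \<sigma>_pos[of j] in auto)
    ultimately show ?case using D pole_facts(2)[of j] by simp
  qed
qed

text \<open>The index counts the poles \<open>2 (A + k)\<close> of the symbol below \<open>\<sigma> j\<close>.\<close>

lemma pole_index_inj: "inj (\<lambda>j. nat \<lceil>\<sigma> j / 2 - A\<rceil>)"
proof -
  have no: False if "\<sigma> i < \<sigma> j" and eq: "nat \<lceil>\<sigma> i / 2 - A\<rceil> = nat \<lceil>\<sigma> j / 2 - A\<rceil>" for i j
  proof -
    obtain u where "\<sigma> i \<le> u" "u \<le> \<sigma> j" "D (Complex 0 u) = 0"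
    proof -
      \<comment> \<open>Without a zero of D in between, \<theta> would drop below \<kappa> just
        after \<sigma> i and stay there, although it equals \<kappa> at \<sigma> j.\<close>
      have "\<exists>u. \<sigma> i \<le> u \<and> u \<le> \<sigma> j \<and> D (Complex 0 u) = 0"
      proof (rule ccontr)
        assume "\<not> ?thesis"
        hence nz: "D (Complex 0 u) \<noteq> 0" if "\<sigma> i \<le> u" "u \<le> \<sigma> j" for u using that by blast
        have "\<forall>\<^sub>F u in at_right (\<sigma> i). u < \<sigma> j"
          using \<open>\<sigma> i < \<sigma> j\<close> by (auto simp: eventually_at_right_field)
        moreover have "\<forall>\<^sub>F u in at_right (\<sigma> i). \<sigma> i < u"
          by (rule eventually_at_right_less)
        ultimately have "\<forall>\<^sub>F u in at_right (\<sigma> i). False"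
          using \<theta>_right[of i]
        proof eventually_elim
          case (elim u)
          have "\<theta> (\<sigma> j) \<le> \<theta> u"
            by (rule \<theta>_antimono) (use elim nz \<sigma>_pos[of i] in auto)
          thus ?case using elim pole_facts(2)[of j] by simp
        qed
        thus False by simp
      qed
      thus thesis using that by blast
    qed
    then obtain l where l: "u / 2 = A + real l"
    proof -
      have "A + u / 2 \<noteq> - real l" for l
        using A_coef_B_coef[OF \<gamma> \<nu>, of n] \<gamma> \<sigma>_pos[of i] \<open>\<sigma> i \<le> u\<close> by linarith
      hence "rGamma (A - u / 2) = 0"
        using \<open>D (Complex 0 u) = 0\<close> unfolding Theta_den_imag_axis of_real_eq_0_iff
        by (simp add: rGamma_real_eq_0_iff[of "A + u / 2"])
      then obtain l where "A - u / 2 = - real l" unfolding rGamma_real_eq_0_iff by blast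
      thus thesis by (intro that[of l]) linarith
    qed
    \<comment> \<open>The separating zero 2 (A + l) is not \<sigma> j, so l is at least the index of
      \<sigma> i and strictly below that of \<sigma> j. As l \<ge> 0, truncation by
      \<open>nat\<close> does not blur this.\<close>
    have "\<lceil>\<sigma> i / 2 - A\<rceil> \<le> int l"
      using \<open>\<sigma> i \<le> u\<close> l by (simp add: ceiling_le_iff)
    moreover have "u \<noteq> \<sigma> j" using \<open>D (Complex 0 u) = 0\<close> pole_facts(1)[of j] by auto
    hence "int l < \<lceil>\<sigma> j / 2 - A\<rceil>"
      using \<open>u \<le> \<sigma> j\<close> l by (simp add: less_ceiling_iff)
    ultimately show False using eq by linarith
  qed
  show ?thesis
  proof (rule injI)
    fix i j assume "nat \<lceil>\<sigma> i / 2 - A\<rceil> = nat \<lceil>\<sigma> j / 2 - A\<rceil>"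
    hence "\<sigma> i = \<sigma> j" using no[of i j] no[of j i] by (metis linorder_neqE_linordered_idom)
    thus "i = j" using inj_\<sigma> by (simp add: inj_eq)
  qed
qed

text \<open>The index k j is at most \<sigma> j / 2 + 1, as A > 0. Hence the terms are dominated by
  exp (2 \<epsilon>) times a geometric series with ratio exp (- 2 \<epsilon>), sampled along an
  injective sequence of indices.\<close>

lemma summable_exp_poles:
  assumes "\<epsilon> > 0"
  shows "summable (\<lambda>j. exp (- \<epsilon> * \<sigma> j))"
proof -
  define k where "k j = nat \<lceil>\<sigma> j / 2 - A\<rceil>" for j
  have "summable (\<lambda>i. exp (2 * \<epsilon>) * exp (- 2 * \<epsilon>) ^ i)"
    using assms by (intro summable_mult summable_geometric) simp
  hence "summable ((\<lambda>i. exp (2 * \<epsilon>) * exp (- 2 * \<epsilon>) ^ i) \<circ> k)"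
    by (rule summable_reindex) (use pole_index_inj in \<open>simp_all add: k_def[abs_def]\<close>)
  thus ?thesis
  proof (rule summable_comparison_test'[where N = 0])
    fix j
    have "real (k j) \<le> \<sigma> j / 2 + 1"
      using A_coef_B_coef[OF \<gamma> \<nu>, of n] \<gamma> \<sigma>_pos[of j] unfolding k_def by linarith
    hence "2 * \<epsilon> * real (k j) \<le> 2 * \<epsilon> * (\<sigma> j / 2 + 1)"
      using assms by (intro mult_left_mono) auto
    hence "- \<epsilon> * \<sigma> j \<le> 2 * \<epsilon> + real (k j) * (- 2 * \<epsilon>)" by (simp add: algebra_simps)
    hence "exp (- \<epsilon> * \<sigma> j) \<le> exp (2 * \<epsilon> + real (k j) * (- 2 * \<epsilon>))" by simp
    also have "\<dots> = exp (2 * \<epsilon>) * exp (- 2 * \<epsilon>) ^ k j"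
      unfolding exp_add exp_of_nat_mult by simp
    finally show "norm (exp (- \<epsilon> * \<sigma> j)) \<le> ((\<lambda>i. exp (2 * \<epsilon>) * exp (- 2 * \<epsilon>) ^ i) \<circ> k) j"
      by simp
  qed
qed

end

section \<open>Signs of the coefficients\<close>

text \<open>No sign of c is available yet. Convergence at t = 1/2 bounds c j exp (- \<sigma> j / 2)
  by K; another factor exp (- \<sigma> j / 2) makes the sum at |t| = 1 absolutely convergent, and
  beyond it rates \<sigma> j \<ge> \<rho> leave at most exp (- \<rho> (|t| - 1)).\<close>

lemma exp_series_tail_bound:
  fixes c \<sigma> :: "nat \<Rightarrow> real"
  assumes summable: "summable (\<lambda>j. c j * exp (- \<sigma> j * (1/2)))" "summable (\<lambda>j. exp (- (1/2) * \<sigma> j))"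
  obtains C where "C \<ge> 0"
    "\<And>t S. \<lbrakk>\<bar>t\<bar> \<ge> 1; (\<lambda>j. if \<sigma> j < \<rho> then 0 else c j * exp (- \<sigma> j * \<bar>t\<bar>)) sums S\<rbrakk>
        \<Longrightarrow> \<bar>S\<bar> \<le> C * exp (- \<rho> * \<bar>t\<bar>)"
proof -
  have "Bseq (\<lambda>j. c j * exp (- \<sigma> j * (1/2)))"
    by (intro convergent_imp_Bseq convergentI[OF summable_LIMSEQ_zero[OF summable(1)]])
  then obtain K where K: "K > 0" "\<And>j. norm (c j * exp (- \<sigma> j * (1/2))) \<le> K"
    by (auto elim: BseqE)
  have c_bound: "\<bar>c j\<bar> * exp (- \<sigma> j) \<le> K * exp (- (1/2) * \<sigma> j)" for j
  proof -
    have "exp (- \<sigma> j) = exp (- \<sigma> j * (1/2)) * exp (- (1/2) * \<sigma> j)" by (simp flip: exp_add)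
    hence "\<bar>c j\<bar> * exp (- \<sigma> j) = norm (c j * exp (- \<sigma> j * (1/2))) * exp (- (1/2) * \<sigma> j)"
      by (simp add: abs_mult)
    also have "\<dots> \<le> K * exp (- (1/2) * \<sigma> j)" using K by (intro mult_right_mono) auto
    finally show ?thesis .
  qed
  define L where "L = (\<Sum>j. K * exp (- (1/2) * \<sigma> j))"
  have sumK: "summable (\<lambda>j. K * exp (- (1/2) * \<sigma> j))" by (rule summable_mult) (rule summable(2))
  have "L \<ge> 0" unfolding L_def using K sumK by (intro suminf_nonneg) auto
  show thesis
  proof (rule that[of "L * exp \<rho>"])
    fix t S :: real
    assume t: "\<bar>t\<bar> \<ge> 1"
      and S: "(\<lambda>j. if \<sigma> j < \<rho> then 0 else c j * exp (- \<sigma> j * \<bar>t\<bar>)) sums S"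
    let ?a = "\<lambda>j. if \<sigma> j < \<rho> then 0 else c j * exp (- \<sigma> j * \<bar>t\<bar>)"
    have le: "norm (?a j) \<le> K * exp (- (1/2) * \<sigma> j) * exp (- \<rho> * (\<bar>t\<bar> - 1))" for j
    proof (cases "\<sigma> j < \<rho>")
      case False
      have "norm (?a j) = \<bar>c j\<bar> * exp (- \<sigma> j) * exp (- \<sigma> j * (\<bar>t\<bar> - 1))"
        using False by (simp add: abs_mult mult.assoc algebra_simps flip: exp_add)
      also have "\<dots> \<le> K * exp (- (1/2) * \<sigma> j) * exp (- \<rho> * (\<bar>t\<bar> - 1))"
      proof (rule mult_mono[OF c_bound])
        have "\<rho> * (\<bar>t\<bar> - 1) \<le> \<sigma> j * (\<bar>t\<bar> - 1)" using False t by (intro mult_right_mono) auto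
        thus "exp (- \<sigma> j * (\<bar>t\<bar> - 1)) \<le> exp (- \<rho> * (\<bar>t\<bar> - 1))" by simp
      qed (use K in auto)
      finally show ?thesis .
    qed (use K in auto)
    have sumb: "summable (\<lambda>j. K * exp (- (1/2) * \<sigma> j) * exp (- \<rho> * (\<bar>t\<bar> - 1)))"
      by (rule summable_mult2[OF sumK])
    have "norm (\<Sum>j. ?a j) \<le> (\<Sum>j. K * exp (- (1/2) * \<sigma> j) * exp (- \<rho> * (\<bar>t\<bar> - 1)))"
      by (rule norm_suminf_le[OF le sumb])
    also have "\<dots> = L * exp (- \<rho> * (\<bar>t\<bar> - 1))"
      unfolding L_def by (rule suminf_mult2[OF sumK, symmetric])
    also have "exp (- \<rho> * (\<bar>t\<bar> - 1)) = exp \<rho> * exp (- \<rho> * \<bar>t\<bar>)"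
      by (simp add: algebra_simps flip: exp_add)
    finally show "\<bar>S\<bar> \<le> L * exp \<rho> * exp (- \<rho> * \<bar>t\<bar>)"
      using S by (simp add: sums_iff mult.assoc)
  qed (use \<open>L \<ge> 0\<close> in simp)
qed

text \<open>Here \<open>N / D\<close> plays the part of \<Theta> - \<kappa>, with \<open>q\<close>
  its values on the axis. The transform of G is its reciprocal, hence negative just above i \<sigma>
  j, and the coefficient of its principal part there is read off in the limit.\<close>

lemma exp_series_coefficient_nonneg:
  fixes c \<sigma> :: "nat \<Rightarrow> real" and N D :: "complex \<Rightarrow> complex" and q :: "real \<Rightarrow> real"
  assumes \<sigma>_pos: "\<And>j. \<sigma> j > 0" and inj: "inj \<sigma>"
    and summable: "\<And>\<epsilon>. \<epsilon> > 0 \<Longrightarrow> summable (\<lambda>j. exp (- \<epsilon> * \<sigma> j))"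
    and G: "integrable lborel G"
    and series: "\<And>t. t \<noteq> 0 \<Longrightarrow> (\<lambda>j. c j * exp (- \<sigma> j * \<bar>t\<bar>)) sums G t"
    and holo: "N holomorphic_on UNIV" "D holomorphic_on UNIV"
    and fourier: "\<And>\<xi>. N (of_real \<xi>) * fourier G \<xi> = D (of_real \<xi>)"
    and right: "\<forall>\<^sub>F s in at_right (\<sigma> j). D (Complex 0 s) \<noteq> 0 \<and>
       N (Complex 0 s) / D (Complex 0 s) = of_real (q s) \<and> q s < 0"
  shows "c j \<ge> 0"
proof -
  \<comment> \<open>Only \<sigma> j < r < \<rho> matters: i \<sigma> j lies in the disc of radius r,
    and decay of rate \<rho> is integrable against exp (r |t|).\<close>
  define \<rho> where "\<rho> = \<sigma> j + 2"
  define r where "r = \<sigma> j + 1"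
  define J where "J = {i. \<sigma> i < \<rho>}"
  have r: "0 < \<sigma> j" "\<sigma> j < r" "r < \<rho>" using \<sigma>_pos[of j] by (simp_all add: r_def \<rho>_def)
  have "j \<in> J" by (simp add: J_def \<rho>_def)
  have "finite J"
  proof -
    have "(\<lambda>i. exp (- 1 * \<sigma> i)) \<longlonglongrightarrow> 0" by (intro summable_LIMSEQ_zero summable) simp
    hence "\<forall>\<^sub>F i in sequentially. exp (- 1 * \<sigma> i) < exp (- \<rho>)"
      by (rule order_tendstoD) simp
    then obtain n where n: "\<And>i. i \<ge> n \<Longrightarrow> exp (- 1 * \<sigma> i) < exp (- \<rho>)"
      by (auto simp: eventually_sequentially)
    have "J \<subseteq> {..<n}"
    proof
      fix i assume "i \<in> J"
      thus "i \<in> {..<n}" using n[of i] by (cases "i \<ge> n") (auto simp: J_def)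
    qed
    thus ?thesis by (rule finite_subset) simp
  qed
  define T where "T t = G t - (\<Sum>i\<in>J. c i * exp (- \<sigma> i * \<bar>t\<bar>))" for t
  have E: "has_bochner_integral lborel (\<lambda>t. exp (- \<sigma> i * \<bar>t\<bar>)) (2 / \<sigma> i)" for i
    by (rule has_bochner_integral_exp_abs[OF \<sigma>_pos])
  have E_int: "integrable lborel (\<lambda>t. exp (- \<sigma> i * \<bar>t\<bar>))" for i
    using E[of i] by (simp add: has_bochner_integral_iff)
  have T: "integrable lborel T"
    unfolding T_def by (intro Bochner_Integration.integrable_diff G
        Bochner_Integration.integrable_sum integrable_mult_right E_int)
  have [measurable]: "T \<in> borel_measurable borel" using borel_measurable_integrable[OF T] by simp
  have T_int: "integrable lborel (\<lambda>t. \<bar>T t\<bar> * exp (r * \<bar>t\<bar>))"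
  proof -
    have s1: "summable (\<lambda>j. c j * exp (- \<sigma> j * (1/2)))"
      using series[of "1/2"] by (simp add: sums_iff)
    have s2: "summable (\<lambda>j. exp (- (1/2) * \<sigma> j))" by (rule summable) simp
    obtain C where C: "C \<ge> 0" and tail: "\<And>t S. \<lbrakk>\<bar>t\<bar> \<ge> 1;
        (\<lambda>j. if \<sigma> j < \<rho> then 0 else c j * exp (- \<sigma> j * \<bar>t\<bar>)) sums S\<rbrakk> \<Longrightarrow> \<bar>S\<bar> \<le> C * exp (- \<rho> * \<bar>t\<bar>)"
      by (rule exp_series_tail_bound[OF s1 s2, where \<rho> = \<rho>]) blast
    have T_tail: "\<bar>T t\<bar> \<le> C * exp (- \<rho> * \<bar>t\<bar>)" if "\<bar>t\<bar> \<ge> 1" for t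
    proof (rule tail[OF that])
      have "(\<lambda>i. if i \<in> J then c i * exp (- \<sigma> i * \<bar>t\<bar>) else 0) sums (\<Sum>i\<in>J. c i * exp (- \<sigma> i * \<bar>t\<bar>))"
        using \<open>finite J\<close> by (rule sums_If_finite_set)
      hence "(\<lambda>i. c i * exp (- \<sigma> i * \<bar>t\<bar>) - (if i \<in> J then c i * exp (- \<sigma> i * \<bar>t\<bar>) else 0)) sums T t"
        unfolding T_def using that by (intro sums_diff series) auto
      thus "(\<lambda>i. if \<sigma> i < \<rho> then 0 else c i * exp (- \<sigma> i * \<bar>t\<bar>)) sums T t"
        by (rule sums_cong[THEN iffD1, rotated]) (simp add: J_def)
    qed
    have "integrable lborel (\<lambda>t. exp r * \<bar>T t\<bar> + C * exp (- (\<rho> - r) * \<bar>t\<bar>))"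
      using has_bochner_integral_exp_abs[of "\<rho> - r"] T r by (simp add: has_bochner_integral_iff)
    thus ?thesis
    proof (rule Bochner_Integration.integrable_bound)
      \<comment> \<open>The tail bound serves for |t| \<ge> 1. Near 0, where the series gives no
        control, the weight is at most exp r and integrability of T suffices.\<close>
      have "\<bar>T t\<bar> * exp (r * \<bar>t\<bar>) \<le> exp r * \<bar>T t\<bar> + C * exp (- (\<rho> - r) * \<bar>t\<bar>)" for t
      proof (cases "\<bar>t\<bar> \<ge> 1")
        case True
        have "\<bar>T t\<bar> * exp (r * \<bar>t\<bar>) \<le> C * exp (- \<rho> * \<bar>t\<bar>) * exp (r * \<bar>t\<bar>)"
          using T_tail[OF True] by (rule mult_right_mono) simp
        also have "\<dots> = C * exp (- (\<rho> - r) * \<bar>t\<bar>)"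
          by (simp add: algebra_simps flip: exp_add)
        finally show ?thesis by (simp add: add_increasing)
      next
        case False
        have "r * \<bar>t\<bar> \<le> r * 1" using False r by (intro mult_left_mono) auto
        hence "\<bar>T t\<bar> * exp (r * \<bar>t\<bar>) \<le> \<bar>T t\<bar> * exp r" by (intro mult_left_mono) auto
        thus ?thesis using C by (simp add: add_increasing2 mult.commute)
      qed
      thus "AE t in lborel. norm (\<bar>T t\<bar> * exp (r * \<bar>t\<bar>)) \<le> norm (exp r * \<bar>T t\<bar> + C * exp (- (\<rho> - r) * \<bar>t\<bar>))"
        by (intro AE_I2) (smt (verit) real_norm_def mult_nonneg_nonneg abs_ge_zero exp_ge_zero)
    qed simp
  qed
  define That where "That z = (LINT t|lborel. exp (- (\<i> * (z * of_real t))) * of_real (T t))" for z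
  have holo_That: "That holomorphic_on ball 0 r"
    unfolding That_def by (rule fourier_integral_holomorphic[OF _ T_int]) simp
  define F where "F z = (\<Sum>i\<in>J. of_real (c i) * (of_real (2 * \<sigma> i) / (of_real (\<sigma> i) ^ 2 + z ^ 2))) + That z" for z
  have fourier_G: "fourier G \<xi> = F (of_real \<xi>)" for \<xi>
  proof -
    let ?e = "\<lambda>t. exp (- (\<i> * of_real (\<xi> * t))) :: complex"
    have "has_bochner_integral lborel (\<lambda>t. \<Sum>i\<in>J. of_real (c i) * (?e t * of_real (exp (- \<sigma> i * \<bar>t\<bar>))))
        (\<Sum>i\<in>J. of_real (c i) * (of_real (2 * \<sigma> i) / (of_real (\<sigma> i) ^ 2 + of_real \<xi> ^ 2)))"
      by (intro has_bochner_integral_sum has_bochner_integral_mult_right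
          has_bochner_integral_fourier_exp_abs \<sigma>_pos)
    moreover have "has_bochner_integral lborel (\<lambda>t. ?e t * of_real (T t)) (That (of_real \<xi>))"
    proof -
      have "integrable lborel (\<lambda>t. ?e t * of_real (T t))"
        by (rule Bochner_Integration.integrable_bound[OF T]) (auto simp: norm_mult norm_exp_eq_Re)
      thus ?thesis by (simp add: has_bochner_integral_iff That_def)
    qed
    ultimately have "has_bochner_integral lborel (\<lambda>t. (\<Sum>i\<in>J. of_real (c i) *
        (?e t * of_real (exp (- \<sigma> i * \<bar>t\<bar>)))) + ?e t * of_real (T t)) (F (of_real \<xi>))"
      unfolding F_def by (rule has_bochner_integral_add)
    moreover have "(\<Sum>i\<in>J. of_real (c i) * (?e t * of_real (exp (- \<sigma> i * \<bar>t\<bar>)))) + ?e t * of_real (T t)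
        = ?e t * of_real (G t)" for t
      by (simp add: T_def sum_distrib_left algebra_simps)
    ultimately show ?thesis by (simp add: has_bochner_integral_iff fourier_def)
  qed
  define P where "P = (\<lambda>i. Complex 0 (\<sigma> i)) ` J \<union> (\<lambda>i. Complex 0 (- \<sigma> i)) ` J"
  have nonzero: "of_real (\<sigma> i) ^ 2 + z ^ 2 \<noteq> 0" if "z \<notin> P" "i \<in> J" for i z
  proof
    assume "of_real (\<sigma> i) ^ 2 + z ^ 2 = 0"
    hence "(z - \<i> * of_real (\<sigma> i)) * (z + \<i> * of_real (\<sigma> i)) = 0"
      by (simp add: algebra_simps power2_eq_square)
    hence "z - \<i> * of_real (\<sigma> i) = 0 \<or> z + \<i> * of_real (\<sigma> i) = 0"
      by (simp only: mult_eq_0_iff)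
    hence "z = Complex 0 (\<sigma> i) \<or> z = Complex 0 (- \<sigma> i)"
      by (auto simp: complex_eq_iff)
    thus False using that by (auto simp: P_def)
  qed
  \<comment> \<open>The identity is continued in product form, so zeros of N do no harm. Removing
    the finite set P keeps the disc connected; the real segment avoids P and accumulates at
    0.\<close>
  have identity: "N z * F z - D z = 0" if "z \<in> ball 0 r - P" for z
  proof (rule analytic_continuation[where f = "\<lambda>z. N z * F z - D z" and S = "ball 0 r - P"
        and U = "of_real ` {- r<..<r}" and \<xi> = 0 and w = z])
    have "finite P" using \<open>finite J\<close> by (simp add: P_def)
    thus "open (ball 0 r - P)" by (intro open_Diff finite_imp_closed) auto
    show "connected (ball 0 r - P)"
      using \<open>finite P\<close> by (intro connected_open_delete_finite) auto
    show "(\<lambda>z. N z * F z - D z) holomorphic_on ball 0 r - P"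
      unfolding F_def using nonzero
      by (intro holomorphic_intros holomorphic_on_subset[OF holo(1)] holomorphic_on_subset[OF holo(2)]
          holomorphic_on_subset[OF holo_That]) auto
    have notP: "of_real x \<notin> P" for x
      using \<sigma>_pos by (auto simp: P_def complex_eq_iff less_le)
    show "of_real ` {- r<..<r} \<subseteq> ball 0 r - P" using notP by (auto simp: dist_norm)
    show "0 \<in> ball 0 r - P" using notP[of 0] r by simp
    show "0 islimpt (of_real ` {- r<..<r} :: complex set)"
      unfolding islimpt_approachable
    proof (intro allI impI)
      fix e :: real assume "e > 0"
      have "of_real (min r e / 2) \<in> (of_real ` {- r<..<r} :: complex set)"
        using r \<open>e > 0\<close> by (intro imageI) auto
      thus "\<exists>x'\<in>of_real ` {- r<..<r}. x' \<noteq> (0::complex) \<and> dist x' 0 < e"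
        using r \<open>e > 0\<close> by (intro bexI[of _ "of_real (min r e / 2)"]) (auto simp: dist_norm min_def)
    qed
    show "N z * F z - D z = 0" if "z \<in> of_real ` {- r<..<r}" for z
      using that fourier by (auto simp: fourier_G[symmetric])
  qed (rule that)
  \<comment> \<open>The part of F that stays regular at i \<sigma> j: the other \<sigma> i are
    distinct and positive, so their denominators do not vanish there.\<close>
  define Q where "Q s = (\<Sum>i\<in>J - {j}. c i * (2 * \<sigma> i / ((\<sigma> i)\<^sup>2 - s\<^sup>2))) + Re (That (Complex 0 s))" for s
  have Re_F: "Re (F (Complex 0 s)) = c j * (2 * \<sigma> j / ((\<sigma> j)\<^sup>2 - s\<^sup>2)) + Q s" for s
  proof -
    have "Complex 0 s ^ 2 = of_real (- (s\<^sup>2))" by (simp add: complex_eq_iff power2_eq_square)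
    hence "Re (of_real (c i) * (of_real (2 * \<sigma> i) / (of_real (\<sigma> i) ^ 2 + Complex 0 s ^ 2))) =
        c i * (2 * \<sigma> i / ((\<sigma> i)\<^sup>2 - s\<^sup>2))" for i
      by (simp only: of_real_power[symmetric] of_real_add[symmetric] of_real_divide[symmetric]
          of_real_mult[symmetric] Re_complex_of_real) simp
    thus ?thesis unfolding F_def Q_def using \<open>finite J\<close> \<open>j \<in> J\<close>
      by (simp add: sum.remove[of J j])
  qed
  have Q_lim: "(Q \<longlongrightarrow> Q (\<sigma> j)) (at_right (\<sigma> j))"
    unfolding Q_def
  proof (intro tendsto_intros)
    have "(\<sigma> i)\<^sup>2 \<noteq> (\<sigma> j)\<^sup>2" if "i \<in> J - {j}" for i
      using that \<sigma>_pos[of i] \<sigma>_pos[of j] inj by (auto simp: power2_eq_iff inj_eq)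
    thus "(\<sigma> i)\<^sup>2 - (\<sigma> j)\<^sup>2 \<noteq> 0" if "i \<in> J - {j}" for i using that by simp
    have "Complex 0 (\<sigma> j) \<in> ball 0 r" using r by (simp add: dist_norm complex_norm)
    hence "isCont That (Complex 0 (\<sigma> j))"
      using holomorphic_on_imp_continuous_on[OF holo_That] by (simp add: continuous_on_eq_continuous_at)
    thus "((\<lambda>s. That (Complex 0 s)) \<longlongrightarrow> That (Complex 0 (\<sigma> j))) (at_right (\<sigma> j))"
      by (rule isCont_tendsto_compose) (intro tendsto_Complex tendsto_const tendsto_ident_at)
  qed
  \<comment> \<open>Multiplication by (\<sigma> j)^2 - s^2 removes the singular term and annihilates
    the regular part in the limit, leaving 2 \<sigma> j c j.\<close>
  have lim: "((\<lambda>s. c j * (2 * \<sigma> j) + ((\<sigma> j)\<^sup>2 - s\<^sup>2) * Q s) \<longlongrightarrow>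
      c j * (2 * \<sigma> j) + ((\<sigma> j)\<^sup>2 - (\<sigma> j)\<^sup>2) * Q (\<sigma> j)) (at_right (\<sigma> j))"
    by (intro tendsto_intros Q_lim)
  have "\<forall>\<^sub>F s in at_right (\<sigma> j). 0 \<le> c j * (2 * \<sigma> j) + ((\<sigma> j)\<^sup>2 - s\<^sup>2) * Q s"
  proof -
    have "\<forall>\<^sub>F s in at_right (\<sigma> j). s < r"
      by (rule order_tendstoD(2)[OF tendsto_ident_at]) (use r in simp)
    moreover have "\<forall>\<^sub>F s in at_right (\<sigma> j). \<forall>i\<in>J. s \<noteq> \<sigma> i"
      using \<open>finite J\<close> by (intro eventually_ball_finite ballI eventually_neq_at_within)
    moreover have "\<forall>\<^sub>F s in at_right (\<sigma> j). \<sigma> j < s" by (rule eventually_at_right_less)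
    ultimately show ?thesis using right
    proof eventually_elim
      case (elim s)
      have "Complex 0 s \<notin> P"
      proof -
        have "s \<noteq> - \<sigma> i" for i using elim(3) r \<sigma>_pos[of i] by linarith
        thus ?thesis using elim(2) by (auto simp: P_def)
      qed
      moreover have "Complex 0 s \<in> ball 0 r" using elim r by (simp add: dist_norm complex_norm)
      ultimately have "N (Complex 0 s) * F (Complex 0 s) = D (Complex 0 s)"
        using identity[of "Complex 0 s"] by simp
      hence "N (Complex 0 s) / D (Complex 0 s) * F (Complex 0 s) = D (Complex 0 s) / D (Complex 0 s)"
        by (simp only: times_divide_eq_left)
      also have "\<dots> = 1" using elim(4) by (intro divide_self) blast
      finally have "N (Complex 0 s) / D (Complex 0 s) * F (Complex 0 s) = 1" .
      moreover have "N (Complex 0 s) / D (Complex 0 s) = of_real (q s)" using elim(4) by simp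
      ultimately have "Re (of_real (q s) * F (Complex 0 s)) = Re 1" by (simp only:)
      \<comment> \<open>Both Re F and (\<sigma> j)^2 - s^2 are negative just above \<sigma> j, so
        their product is nonnegative.\<close>
      hence "q s * Re (F (Complex 0 s)) > 0" by simp
      hence "Re (F (Complex 0 s)) < 0" using elim(4) by (simp add: zero_less_mult_iff)
      moreover have neg: "(\<sigma> j)\<^sup>2 - s\<^sup>2 < 0"
        using elim(3) r power_strict_mono[of "\<sigma> j" s 2] by simp
      ultimately have "0 \<le> ((\<sigma> j)\<^sup>2 - s\<^sup>2) * Re (F (Complex 0 s))"
        by (intro mult_nonpos_nonpos) auto
      also have "\<dots> = c j * (2 * \<sigma> j) + ((\<sigma> j)\<^sup>2 - s\<^sup>2) * Q s"
        unfolding Re_F using neg by (simp add: field_simps)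
      finally show ?case .
    qed
  qed
  hence "0 \<le> c j * (2 * \<sigma> j) + ((\<sigma> j)\<^sup>2 - (\<sigma> j)\<^sup>2) * Q (\<sigma> j)"
    by (intro tendsto_lowerbound[OF lim]) auto
  thus ?thesis using \<sigma>_pos[of j] by (simp add: zero_le_mult_iff)
qed

section \<open>The series representation and the differential equations\<close>

theorem corollary4p6:
  fixes \<gamma> \<kappa> \<delta> \<delta>0 :: real and n m :: nat
    and \<mu> :: "nat \<Rightarrow> real" and Y :: "nat \<Rightarrow> real^'n::finite \<Rightarrow> real"
    and \<sigma> \<tau> c c' :: "nat \<Rightarrow> real"
    and h w :: "real \<Rightarrow> real" and wj :: "nat \<Rightarrow> real \<Rightarrow> real"
  assumes "0 < \<gamma>" and "\<gamma> < 1" and "n \<ge> 2" and "CARD('n) = n"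
    and "0 \<le> \<kappa>" and "\<kappa> < Lambda_const n \<gamma>"
    and "spherical_harmonics \<mu> Y"
    and "pole_enumeration (Theta n \<gamma> (\<mu> m)) \<kappa> \<sigma> \<tau>"
    and "green_coefficients (Theta n \<gamma> (\<mu> m)) \<kappa> \<sigma> \<tau> c c'"
    and "continuous_on UNIV h"
    and "exp_decay \<delta> \<delta>0 h" and "\<delta> > - \<sigma> 0" and "\<delta>0 > - \<sigma> 0"
    and "\<And>t. w t = conv (green_series \<sigma> \<tau> c c') h t"
    and "\<And>j t. wj j t = conv (\<lambda>s. exp (- \<sigma> j * \<bar>s\<bar>)) h t"
    and "\<forall>j. \<tau> j = 0"
  shows "(\<forall>t. integrable lborel (\<lambda>s. green_series \<sigma> \<tau> c c' (t - s) * h s) \<and>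
            (\<forall>j. integrable lborel (\<lambda>s. exp (- \<sigma> j * \<bar>t - s\<bar>) * h s)) \<and>
            (\<lambda>j. c j * wj j t) sums w t) \<and>
         (\<forall>j t. wj j differentiable (at t) \<and> deriv (wj j) differentiable (at t) \<and>
            deriv (deriv (wj j)) t - (\<sigma> j)\<^sup>2 * wj j t = - 2 * \<sigma> j * h t)"
proof -
  define \<nu> where "\<nu> = \<mu> m"
  define G where "G = green_series \<sigma> \<tau> c c'"
  note \<tau> = \<open>\<forall>j. \<tau> j = 0\<close>
  have \<nu>: "0 \<le> \<nu>" unfolding \<nu>_def by (rule spherical_harmonics_eigenvalue_nonneg) fact
  have \<sigma>0: "\<sigma> 0 > 0" "\<And>j. \<sigma> 0 \<le> \<sigma> j"
    and poles: "\<And>j. is_pole (\<lambda>z. 1 / (Theta n \<gamma> \<nu> z - of_real \<kappa>)) (Complex 0 (\<sigma> j))"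
    and inj: "inj \<sigma>"
  proof -
    note enum = \<open>pole_enumeration _ _ _ _\<close>[folded \<nu>_def, unfolded pole_enumeration_def]
    show "\<sigma> 0 > 0" using enum by blast
    show "\<sigma> 0 \<le> \<sigma> j" for j using enum by (cases "j = 0") (auto simp: less_imp_le)
    have "Complex (\<tau> j) (\<sigma> j) \<in> {z. is_pole (\<lambda>z. 1 / (Theta n \<gamma> \<nu> z - of_real \<kappa>)) z}" for j
      using enum by blast
    thus "is_pole (\<lambda>z. 1 / (Theta n \<gamma> \<nu> z - of_real \<kappa>)) (Complex 0 (\<sigma> j))" for j
      using \<tau> by simp
    have "inj (\<lambda>j. (\<tau> j, \<sigma> j))" using enum by blast
    thus "inj \<sigma>" using \<tau> by (auto simp: inj_def)
  qed
  have \<sigma>_pos: "\<sigma> j > 0" for j using \<sigma>0(1) \<sigma>0(2)[of j] by linarith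
  interpret axial_poles n \<gamma> \<nu> \<kappa> \<sigma>
    by standard (use assms(1,2) \<nu> \<sigma>_pos inj poles in auto)
  have green: "green_function (Theta n \<gamma> \<nu>) \<kappa> G"
    and sum: "\<And>t. t \<noteq> 0 \<Longrightarrow> summable (\<lambda>j. green_term \<sigma> \<tau> c c' t (Suc j))"
    using \<open>green_coefficients _ _ _ _ _ _\<close> by (simp_all add: green_coefficients_def G_def \<nu>_def)
  have G: "integrable lborel G" using green by (simp add: green_function_def)
  have series: "(\<lambda>j. c j * exp (- \<sigma> j * \<bar>t\<bar>)) sums G t" if "t \<noteq> 0" for t
  proof -
    have "(\<lambda>j. c (Suc j) * exp (- \<sigma> (Suc j) * \<bar>t\<bar>)) sums (\<Sum>j. green_term \<sigma> \<tau> c c' t (Suc j))"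
      using summable_sums[OF sum[OF that]] \<tau> by (simp add: green_term_def mult.commute)
    \<comment> \<open>With \<tau> = 0 the sine terms vanish; the shift restores the term j = 0,
      which \<open>green_series\<close> keeps outside its sum.\<close>
    from sums_Suc[OF this] show ?thesis by (simp add: G_def green_series_def add.commute)
  qed
  have c_nonneg: "c j \<ge> 0" for j
  \<comment> \<open>The numerator in this instance is N - \<kappa> D, the denominator D, and the
    real quotient on the axis \<theta> - \<kappa>.\<close>
  proof (rule exp_series_coefficient_nonneg[OF \<sigma>_pos inj summable_exp_poles G series])
    show "(\<lambda>z. N z - of_real \<kappa> * D z) holomorphic_on UNIV"
      by (intro holomorphic_intros holomorphic_Theta_num holomorphic_Theta_den)
    show "D holomorphic_on UNIV" by (rule holomorphic_Theta_den)
    show "(N (of_real \<xi>) - of_real \<kappa> * D (of_real \<xi>)) * fourier G \<xi> = D (of_real \<xi>)" for \<xi>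
      using fourier_green_function[OF green, of \<xi>] Theta_den_real_nonzero[OF assms(1,2) \<nu>, of n \<xi>]
      by (simp add: Theta_eq_quotient field_simps)
    show "\<forall>\<^sub>F s in at_right (\<sigma> j). D (Complex 0 s) \<noteq> 0 \<and>
        (N (Complex 0 s) - of_real \<kappa> * D (Complex 0 s)) / D (Complex 0 s) = of_real (\<theta> s - \<kappa>) \<and> \<theta> s - \<kappa> < 0"
      using \<theta>_right[of j]
    proof eventually_elim
      case (elim s)
      hence "(N (Complex 0 s) - of_real \<kappa> * D (Complex 0 s)) / D (Complex 0 s) =
          Theta n \<gamma> \<nu> (Complex 0 s) - of_real \<kappa>"
        by (simp add: Theta_eq_quotient field_simps)
      thus ?case using elim by (simp add: Theta_imag_axis)
    qed
  qed
  obtain \<eta> M where \<eta>: "0 \<le> \<eta>" "\<eta> < \<sigma> 0" "0 \<le> M"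
    and bound: "\<And>t. \<bar>h t\<bar> \<le> M * exp (\<eta> * \<bar>t\<bar>)"
    using exp_decay_imp_exp_bound[OF \<open>exp_decay \<delta> \<delta>0 h\<close> \<open>\<delta> > - \<sigma> 0\<close> \<open>\<delta>0 > - \<sigma> 0\<close> \<sigma>0(1)
        \<open>continuous_on UNIV h\<close>] by (elim exE conjE) blast
  have h: "h \<in> borel_measurable borel"
    using \<open>continuous_on UNIV h\<close> by (rule borel_measurable_continuous_onI)
  note conv = conv_nonneg_exp_series[OF c_nonneg \<sigma>0(2,1) G series h bound \<eta>(1,2,3)]
  have kernel: "integrable lborel (\<lambda>s. exp (- \<sigma> j * \<bar>t - s\<bar>) * h s)" for j t
    using exp_kernel_bound(1)[OF h bound \<eta>(1) _ \<eta>(3)] \<eta>(2) \<sigma>0(2)[of j] by simp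
  note ode = exp_kernel_ode[OF \<open>continuous_on UNIV h\<close> kernel, of "wj j" j for j]
  show ?thesis
    using conv kernel ode assms(14,15) by (simp add: conv_def G_def)
qed

end
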